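(* Let $L,M,N,R\in\mathbb{N}$, let $p,q\in\mathbb{N}$ be coprime with $N/M=p/q$, and let $\mathbb{S}\subset\mathbb{Z}$ be an $N\mathbb{Z}$-periodic set. The following statements are equivalent. (1) There exists $g=\{g_l\}_{l\in\mathbb{N}_L}\subset\ell^2(\mathbb{S},\mathbb{C}^R)$ such that $\mathcal{G}(g,L,M,N,R)$ is a Parseval frame for $\ell^2(\mathbb{S},\mathbb{C}^R)$. (2) There exists $g=\{g_l\}_{l\in\mathbb{N}_L}\subset\ell^2(\mathbb{S},\mathbb{C}^R)$ such that $\mathcal{G}(g,L,M,N,R)$ is a frame for $\ell^2(\mathbb{S},\mathbb{C}^R)$. (3) There exists $g=\{g_l\}_{l\in\mathbb{N}_L}\subset\ell^2(\mathbb{S},\mathbb{C}^R)$ such that $\mathcal{G}(g,L,M,N,R)$ is complete in $\ell^2(\mathbb{S},\mathbb{C}^R)$. (4) $R\cdot\operatorname{card}(\mathcal{K}_j)\le qL$ for all $j\in\mathbb{N}_{M/q}$.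
   Context: $\mathbb{N}=\{1,2,3,\dots\}$ and $\mathbb{N}_K=\{0,1,\dots,K-1\}$. A nonempty set $\mathbb{S}\subset\mathbb{Z}$ is $N\mathbb{Z}$-periodic if $j+nN\in\mathbb{S}$ for all $j\in\mathbb{S}$, $n\in\mathbb{Z}$. $\ell^2(\mathbb{S})=\{f\in\ell^2(\mathbb{Z}): f(j)=0 \text{ if } j\notin\mathbb{S}\}$, and $\ell^2(\mathbb{S},\mathbb{C}^R)$ is the Hilbert space of $f=(f_1,\dots,f_R)$ with $f_r\in\ell^2(\mathbb{S})$ and inner product $\sum_{r=1}^R\langle f_r,\tilde f_r\rangle$. Operators (componentwise): $E_{m/M}f(j)=e^{2\pi i mj/M}f(j)$, $T_{nN}f(j)=f(j-nN)$. $\mathcal{G}(g,L,M,N,R)=\{E_{m/M}T_{nN}g_l\}_{m\in\mathbb{N}_M,\,n\in\mathbb{Z},\,l\in\mathbb{N}_L}$. A countable family $\{f_i\}$ in a Hilbert space $\mathcal{U}$ is a frame if there are $0<A\le B<\infty$ with $A\|f\|^2\le\sum_i|\langle f,f_i\rangle|^2\le B\|f\|^2$ for all $f\in\mathcal{U}$; it is a Parseval frame if one can take $A=B=1$; it is complete if its closed linear span is $\mathcal{U}$. $\mathcal{K}_j=\{k\in\mathbb{N}_p: j+kM\in\mathbb{S}\}$. *)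

theory Defs
  imports "HOL-Analysis.Analysis" "HOL-Library.Function_Algebras"
begin

definition periodic_set :: "nat \<Rightarrow> int set \<Rightarrow> bool" where
  "periodic_set N S \<longleftrightarrow> S \<noteq> {} \<and> (\<forall>j\<in>S. \<forall>n::int. j + n * int N \<in> S)"

definition l2 :: "int set \<Rightarrow> (int \<Rightarrow> complex) set" where
  "l2 S = {f. (\<lambda>j. (cmod (f j))\<^sup>2) summable_on UNIV \<and> (\<forall>j. j \<notin> S \<longrightarrow> f j = 0)}"

definition l2_inner :: "(int \<Rightarrow> complex) \<Rightarrow> (int \<Rightarrow> complex) \<Rightarrow> complex" where
  "l2_inner f h = (\<Sum>\<^sub>\<infinity>j\<in>UNIV. f j * cnj (h j))"

text \<open>
  An \<open>R\<close>-tuple of sequences is a function whose component \<open>f r\<close>, \<open>r < R\<close>, is the sequence with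
  one-based index \<open>r + 1\<close>. The components with \<open>r \<ge> R\<close> of an element of \<open>l2_vec R S\<close> are zero,
  so that distinct elements represent distinct tuples.
\<close>

type_synonym vseq = "nat \<Rightarrow> int \<Rightarrow> complex"

definition l2_vec :: "nat \<Rightarrow> int set \<Rightarrow> vseq set" where
  "l2_vec R S = {f. (\<forall>r<R. f r \<in> l2 S) \<and> (\<forall>r\<ge>R. f r = (\<lambda>_. 0))}"

definition vec_inner :: "nat \<Rightarrow> vseq \<Rightarrow> vseq \<Rightarrow> complex" where
  "vec_inner R f h = (\<Sum>r<R. l2_inner (f r) (h r))"

definition vec_norm :: "nat \<Rightarrow> vseq \<Rightarrow> real" where
  "vec_norm R f = sqrt (Re (vec_inner R f f))"

definition vec_scale :: "complex \<Rightarrow> vseq \<Rightarrow> vseq" where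
  "vec_scale c f = (\<lambda>r j. c * f r j)"

text \<open>Vector addition on \<^typ>\<open>vseq\<close> is the pointwise one from \<^theory>\<open>HOL-Library.Function_Algebras\<close>.\<close>

interpretation vseq: vector_space vec_scale
  by unfold_locales (auto simp: vec_scale_def fun_eq_iff algebra_simps)

definition modulation :: "nat \<Rightarrow> nat \<Rightarrow> (int \<Rightarrow> complex) \<Rightarrow> int \<Rightarrow> complex" where
  "modulation M m f = (\<lambda>j. exp (2 * pi * \<i> * of_nat m * of_int j / of_nat M) * f j)"

definition translation :: "int \<Rightarrow> (int \<Rightarrow> complex) \<Rightarrow> int \<Rightarrow> complex" where
  "translation k f = (\<lambda>j. f (j - k))"

text \<open>
  The Gabor system is kept as a family over the triples \<open>(m, n, l)\<close>, so that coinciding members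
  are counted with multiplicity in the frame sums.
\<close>

definition gabor_index :: "nat \<Rightarrow> nat \<Rightarrow> (nat \<times> int \<times> nat) set" where
  "gabor_index L M = {..<M} \<times> UNIV \<times> {..<L}"

definition gabor :: "(nat \<Rightarrow> vseq) \<Rightarrow> nat \<Rightarrow> nat \<Rightarrow> nat \<times> int \<times> nat \<Rightarrow> vseq" where
  "gabor g M N = (\<lambda>(m, n, l) r. modulation M m (translation (n * int N) (g l r)))"

text \<open>
  In the definitions below, the space \<open>U\<close> carries the inner product \<^term>\<open>vec_inner R\<close>.
  Summability is required explicitly, because \<^const>\<open>infsum\<close> of a divergent family is \<open>0\<close>.
\<close>

definition frame_bounds ::
    "nat \<Rightarrow> vseq set \<Rightarrow> real \<Rightarrow> real \<Rightarrow> 'i set \<Rightarrow> ('i \<Rightarrow> vseq) \<Rightarrow> bool" where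
  "frame_bounds R U A B I F \<longleftrightarrow>
     countable I \<and> F ` I \<subseteq> U \<and> 0 < A \<and> A \<le> B \<and>
     (\<forall>f\<in>U. (\<lambda>i. (cmod (vec_inner R f (F i)))\<^sup>2) summable_on I \<and>
        A * (vec_norm R f)\<^sup>2 \<le> (\<Sum>\<^sub>\<infinity>i\<in>I. (cmod (vec_inner R f (F i)))\<^sup>2) \<and>
        (\<Sum>\<^sub>\<infinity>i\<in>I. (cmod (vec_inner R f (F i)))\<^sup>2) \<le> B * (vec_norm R f)\<^sup>2)"

definition is_frame :: "nat \<Rightarrow> vseq set \<Rightarrow> 'i set \<Rightarrow> ('i \<Rightarrow> vseq) \<Rightarrow> bool" where
  "is_frame R U I F \<longleftrightarrow> (\<exists>A B. frame_bounds R U A B I F)"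

definition is_parseval_frame :: "nat \<Rightarrow> vseq set \<Rightarrow> 'i set \<Rightarrow> ('i \<Rightarrow> vseq) \<Rightarrow> bool" where
  "is_parseval_frame R U I F \<longleftrightarrow> frame_bounds R U 1 1 I F"

definition norm_closure :: "nat \<Rightarrow> vseq set \<Rightarrow> vseq set \<Rightarrow> vseq set" where
  "norm_closure R U V = {f\<in>U. \<forall>\<epsilon>>0. \<exists>h\<in>V. vec_norm R (f - h) < \<epsilon>}"

definition is_complete :: "nat \<Rightarrow> vseq set \<Rightarrow> 'i set \<Rightarrow> ('i \<Rightarrow> vseq) \<Rightarrow> bool" where
  "is_complete R U I F \<longleftrightarrow>
     countable I \<and> F ` I \<subseteq> U \<and> norm_closure R U (vseq.span (F ` I)) = U"

definition K_set :: "nat \<Rightarrow> nat \<Rightarrow> int set \<Rightarrow> int \<Rightarrow> nat set" where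
  "K_set p M S j = {k. k < p \<and> j + int k * int M \<in> S}"

end

theory Submission
  imports Defs
begin

text \<open>
  Write \<open>M = q d\<close> and \<open>N = p d\<close>. Summing over the modulations splits the system into classes modulo
  \<open>M\<close>, and the argument is elementary counting on each class modulo \<open>d\<close>, without the Zak transform.

  If the system is complete, the unit vectors at the points \<open>j + kM + nN\<close> with \<open>j + kM \<in> S\<close> and
  \<open>0 \<le> n < W\<close> are approximated from a space of dimension at most \<open>q L (W + 2 B)\<close>. An orthonormal
  system of size \<open>m\<close> uniformly \<open>\<epsilon>\<close>-close in square distance to a space of dimension \<open>s\<close> satisfies
  \<open>m (1 - \<epsilon>) \<le> s\<close>, and letting \<open>W\<close> grow gives \<open>R card K\<^sub>j \<le> q L\<close>.

  Conversely, this inequality provides an injection \<open>(k, r) \<mapsto> (l, n)\<close> from \<open>K\<^sub>c \<times> {..<R}\<close> to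
  \<open>{..<L} \<times> {..<q}\<close>. Putting a mass \<open>M\<^bsup>-1/2\<^esup>\<close> at the point \<open>c + kM + nN\<close> of component \<open>r\<close> of \<open>g\<^sub>l\<close>
  yields a Parseval frame with finitely supported generators.
\<close>

section \<open>The space of vector-valued sequences\<close>


lemma l2_UNIV: "f \<in> l2 S \<Longrightarrow> f \<in> l2 UNIV"
  by (simp add: l2_def)

lemma l2_dominated:
  assumes "\<And>j. (cmod (h j))\<^sup>2 \<le> k j" and "k summable_on UNIV" and "\<And>j. j \<notin> S \<Longrightarrow> h j = 0"
  shows "h \<in> l2 S"
  unfolding l2_def using assms
  by (auto intro!: summable_on_comparison_test[OF assms(2)])

lemma l2_add:
  assumes "f \<in> l2 S" "h \<in> l2 S"
  shows "(\<lambda>j. f j + h j) \<in> l2 S"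
proof (rule l2_dominated[where k = "\<lambda>j. 2 * (cmod (f j))\<^sup>2 + 2 * (cmod (h j))\<^sup>2"])
  fix j
  have "(cmod (f j + h j))\<^sup>2 \<le> (cmod (f j) + cmod (h j))\<^sup>2"
    by (simp add: norm_triangle_ineq power_mono)
  also have "\<dots> \<le> 2 * (cmod (f j))\<^sup>2 + 2 * (cmod (h j))\<^sup>2"
    using sum_squares_bound[of "cmod (f j)" "cmod (h j)"] by (simp add: power2_sum)
  finally show "(cmod (f j + h j))\<^sup>2 \<le> 2 * (cmod (f j))\<^sup>2 + 2 * (cmod (h j))\<^sup>2" .
qed (use assms in \<open>auto simp: l2_def intro!: summable_on_add summable_on_cmult_right\<close>)

lemma l2_scale:
  assumes "f \<in> l2 S"
  shows "(\<lambda>j. c * f j) \<in> l2 S"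
  using assms by (auto simp: l2_def norm_mult power_mult_distrib intro!: summable_on_cmult_right)

text \<open>The arithmetic-geometric mean inequality dominates the products by a sum of two summable
  squares, so the inner product converges absolutely.\<close>

lemma l2_inner_summable:
  assumes "f \<in> l2 UNIV" "h \<in> l2 UNIV"
  shows "(\<lambda>j. f j * cnj (h j)) summable_on UNIV"
proof (rule abs_summable_summable, rule summable_on_comparison_test)
  show "(\<lambda>j. (cmod (f j))\<^sup>2 + (cmod (h j))\<^sup>2) summable_on UNIV"
    using assms by (auto simp: l2_def intro: summable_on_add)
next
  fix j
  have "2 * (cmod (f j) * cmod (h j)) \<le> (cmod (f j))\<^sup>2 + (cmod (h j))\<^sup>2"
    using sum_squares_bound[of "cmod (f j)" "cmod (h j)"] by simp
  moreover have "0 \<le> cmod (f j) * cmod (h j)" by simp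
  ultimately have "cmod (f j) * cmod (h j) \<le> (cmod (f j))\<^sup>2 + (cmod (h j))\<^sup>2"
    by linarith
  then show "norm (f j * cnj (h j)) \<le> (cmod (f j))\<^sup>2 + (cmod (h j))\<^sup>2"
    by (simp add: norm_mult)
qed simp

lemma l2_vecD: "f \<in> l2_vec R S \<Longrightarrow> r < R \<Longrightarrow> f r \<in> l2 UNIV"
  by (auto simp: l2_vec_def dest: l2_UNIV)

lemma subspace_l2_vec: "vseq.subspace (l2_vec R S)"
proof (rule vseq.subspaceI)
  show "0 \<in> l2_vec R S" by (auto simp: l2_vec_def l2_def zero_fun_def)
next
  fix f h assume "f \<in> l2_vec R S" "h \<in> l2_vec R S"
  then show "f + h \<in> l2_vec R S"
    by (auto simp: l2_vec_def plus_fun_def intro: l2_add)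
next
  fix c f assume "f \<in> l2_vec R S"
  then show "vec_scale c f \<in> l2_vec R S"
    by (auto simp: l2_vec_def vec_scale_def intro: l2_scale)
qed

lemmas l2_vec_add = vseq.subspace_add[OF subspace_l2_vec]
  and l2_vec_diff = vseq.subspace_diff[OF subspace_l2_vec]
  and l2_vec_scale = vseq.subspace_scale[OF subspace_l2_vec]
  and l2_vec_sum = vseq.subspace_sum[OF subspace_l2_vec]
  and l2_vec_zero = vseq.subspace_0[OF subspace_l2_vec]

section \<open>Sesquilinearity of the inner product\<close>

lemma vec_inner_add_left:
  assumes "f \<in> l2_vec R S" "h \<in> l2_vec R S" "k \<in> l2_vec R S"
  shows "vec_inner R (f + h) k = vec_inner R f k + vec_inner R h k"
proof -
  have "l2_inner ((f + h) r) (k r) = l2_inner (f r) (k r) + l2_inner (h r) (k r)" if "r < R" for r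
    \<comment> \<open>\<open>infsum\<close> is additive only on summable families; membership in
      \<open>l2_vec R S\<close> supplies the summability.\<close>
    unfolding l2_inner_def plus_fun_def distrib_right
    using that assms by (intro infsum_add l2_inner_summable) (auto intro: l2_vecD)
  then show ?thesis by (simp add: vec_inner_def sum.distrib)
qed

lemma vec_inner_scale_left: "vec_inner R (vec_scale c f) k = c * vec_inner R f k"
  by (simp add: vec_inner_def l2_inner_def vec_scale_def mult.assoc infsum_cmult_right'
      sum_distrib_left)

lemma vec_inner_commute: "vec_inner R f h = cnj (vec_inner R h f)"
  by (simp add: vec_inner_def l2_inner_def mult.commute flip: infsum_cnj)

lemma vec_inner_scale_right: "vec_inner R f (vec_scale c k) = cnj c * vec_inner R f k"
  by (metis vec_inner_commute vec_inner_scale_left complex_cnj_mult)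

lemma vec_inner_add_right:
  assumes "f \<in> l2_vec R S" "h \<in> l2_vec R S" "k \<in> l2_vec R S"
  shows "vec_inner R k (f + h) = vec_inner R k f + vec_inner R k h"
  by (metis vec_inner_commute vec_inner_add_left[OF assms] complex_cnj_add)

lemma vec_inner_diff_left:
  assumes "f \<in> l2_vec R S" "h \<in> l2_vec R S" "k \<in> l2_vec R S"
  shows "vec_inner R (f - h) k = vec_inner R f k - vec_inner R h k"
  using vec_inner_add_left[OF l2_vec_diff[OF assms(1,2)] assms(2,3)] by simp

lemma vec_inner_diff_right:
  assumes "f \<in> l2_vec R S" "h \<in> l2_vec R S" "k \<in> l2_vec R S"
  shows "vec_inner R k (f - h) = vec_inner R k f - vec_inner R k h"
  by (metis vec_inner_commute vec_inner_diff_left[OF assms] complex_cnj_diff)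

lemma vec_inner_zero_left: "vec_inner R 0 k = 0"
  by (simp add: vec_inner_def l2_inner_def)

lemma vec_inner_sum_left:
  assumes "\<And>i. i \<in> I \<Longrightarrow> f i \<in> l2_vec R S" "k \<in> l2_vec R S"
  shows "vec_inner R (\<Sum>i\<in>I. f i) k = (\<Sum>i\<in>I. vec_inner R (f i) k)"
  using assms(1)
proof (induction I rule: infinite_finite_induct)
  case (insert i I)
  have "vec_inner R (f i + (\<Sum>i\<in>I. f i)) k = vec_inner R (f i) k + vec_inner R (\<Sum>i\<in>I. f i) k"
    using insert.prems by (intro vec_inner_add_left[OF _ l2_vec_sum assms(2)]) auto
  then show ?case
    using insert by (simp only: sum.insert[OF insert.hyps]) auto
qed (simp_all add: vec_inner_zero_left)

lemma vec_inner_sum_right: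
  assumes "\<And>i. i \<in> I \<Longrightarrow> f i \<in> l2_vec R S" "k \<in> l2_vec R S"
  shows "vec_inner R k (\<Sum>i\<in>I. f i) = (\<Sum>i\<in>I. vec_inner R k (f i))"
  by (subst vec_inner_commute, subst vec_inner_sum_left[OF assms])
    (auto simp: vec_inner_commute[of R k])

lemma infsum_of_real_complex: "(\<Sum>\<^sub>\<infinity>x\<in>A. complex_of_real (f x)) = of_real (\<Sum>\<^sub>\<infinity>x\<in>A. f x)"
proof (cases "f summable_on A")
  case True
  then show ?thesis by (intro infsumI) (simp add: has_sum_of_real_iff)
next
  case False
  \<comment> \<open>Taking real parts would make \<open>f\<close> summable. Hence both sums diverge
    and take the default value 0.\<close>
  then have "\<not> (\<lambda>x. complex_of_real (f x)) summable_on A"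
    using summable_on_Re by fastforce
  then show ?thesis using False by (simp add: infsum_not_exists)
qed

section \<open>The norm: definiteness, Pythagoras and scaling\<close>

lemma vec_inner_self:
  "vec_inner R f f = of_real (\<Sum>r<R. \<Sum>\<^sub>\<infinity>j. (cmod (f r j))\<^sup>2)"
  by (simp only: vec_inner_def l2_inner_def complex_norm_square[symmetric]
      infsum_of_real_complex of_real_sum)

lemma vec_norm_power2:
  "(vec_norm R f)\<^sup>2 = (\<Sum>r<R. \<Sum>\<^sub>\<infinity>j. (cmod (f r j))\<^sup>2)"
  unfolding vec_norm_def vec_inner_self Re_complex_of_real
  by (rule real_sqrt_pow2) (intro sum_nonneg infsum_nonneg, simp)

lemma vec_inner_self_norm: "vec_inner R f f = of_real ((vec_norm R f)\<^sup>2)"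
  by (simp only: vec_inner_self vec_norm_power2)

lemma vec_norm_nonneg: "0 \<le> vec_norm R f"
  unfolding vec_norm_def vec_inner_self Re_complex_of_real
  by (simp add: sum_nonneg infsum_nonneg)

text \<open>Below \<open>R\<close> a vanishing sum of nonnegative terms forces every term to vanish;
  from \<open>R\<close> on the components are zero by the convention in
  \<open>l2_vec\<close>.\<close>

lemma vec_norm_eq_0D:
  assumes "f \<in> l2_vec R S" "vec_norm R f = 0"
  shows "f = 0"
proof -
  have "f r j = 0" for r j
  proof (cases "r < R")
    case True
    have "(\<Sum>r<R. \<Sum>\<^sub>\<infinity>j. (cmod (f r j))\<^sup>2) = 0"
      using assms(2) vec_norm_power2[of R f] by simp
    then have "(\<Sum>\<^sub>\<infinity>j. (cmod (f r j))\<^sup>2) = 0"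
      using True by (subst (asm) sum_nonneg_eq_0_iff) (auto intro!: infsum_nonneg)
    then have "(cmod (f r j))\<^sup>2 = 0"
      using l2_vecD[OF assms(1) True]
      by (intro nonneg_infsum_le_0D[where A = UNIV and f = "\<lambda>j. (cmod (f r j))\<^sup>2"]) (auto simp: l2_def)
    then show ?thesis by simp
  qed (use assms(1) in \<open>auto simp: l2_vec_def\<close>)
  then show ?thesis by (simp add: fun_eq_iff)
qed

lemma vec_norm_add_orthogonal:
  assumes "f \<in> l2_vec R S" "h \<in> l2_vec R S" "vec_inner R f h = 0"
  shows "(vec_norm R (f + h))\<^sup>2 = (vec_norm R f)\<^sup>2 + (vec_norm R h)\<^sup>2"
proof -
  have "vec_inner R h f = 0"
    using assms(3) vec_inner_commute[of R h f] by simp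
  then have "vec_inner R (f + h) (f + h) = vec_inner R f f + vec_inner R h h"
    using assms by (simp add: vec_inner_add_left[of _ R S] vec_inner_add_right[of _ R S] l2_vec_add)
  then show ?thesis
    unfolding vec_inner_self_norm by (metis of_real_add of_real_eq_iff)
qed

lemma vec_norm_scale: "(vec_norm R (vec_scale c f))\<^sup>2 = (cmod c)\<^sup>2 * (vec_norm R f)\<^sup>2"
  by (simp add: vec_norm_power2 vec_scale_def norm_mult power_mult_distrib infsum_cmult_right'
      sum_distrib_left)

section \<open>Orthonormal systems and approximation\<close>

definition orthonormal :: "nat \<Rightarrow> vseq set \<Rightarrow> bool" where
  "orthonormal R B \<longleftrightarrow> (\<forall>a\<in>B. \<forall>b\<in>B. vec_inner R a b = (if a = b then 1 else 0))"

lemma orthonormalD: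
  assumes "orthonormal R B" "a \<in> B" "b \<in> B"
  shows "vec_inner R a b = (if a = b then 1 else 0)"
  using assms by (simp add: orthonormal_def)

text \<open>For a finite orthonormal \<open>B\<close> this is the orthogonal projection onto
  \<open>vseq.span B\<close>.\<close>

definition orth_proj :: "nat \<Rightarrow> vseq set \<Rightarrow> vseq \<Rightarrow> vseq" where
  "orth_proj R B f = (\<Sum>b\<in>B. vec_scale (vec_inner R f b) b)"

lemma orth_proj_in_span: "orth_proj R B f \<in> vseq.span B"
  unfolding orth_proj_def by (intro vseq.span_sum vseq.span_scale vseq.span_base)

lemma orth_proj_in_l2_vec: "B \<subseteq> l2_vec R S \<Longrightarrow> orth_proj R B f \<in> l2_vec R S"
  unfolding orth_proj_def by (intro l2_vec_sum l2_vec_scale) auto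

lemma span_l2_vec: "B \<subseteq> l2_vec R S \<Longrightarrow> v \<in> vseq.span B \<Longrightarrow> v \<in> l2_vec R S"
  using vseq.span_minimal[OF _ subspace_l2_vec] by blast

lemma orth_proj_residual_base:
  assumes B: "orthonormal R B" "finite B" "B \<subseteq> l2_vec R S" and f: "f \<in> l2_vec R S" and b: "b \<in> B"
  shows "vec_inner R (f - orth_proj R B f) b = 0"
proof -
  have "vec_inner R (orth_proj R B f) b = (\<Sum>a\<in>B. vec_inner R f a * vec_inner R a b)"
    unfolding orth_proj_def using B b
    by (subst vec_inner_sum_left[of _ _ R S]) (auto intro: l2_vec_scale simp: vec_inner_scale_left)
  also have "\<dots> = (\<Sum>a\<in>B. if a = b then vec_inner R f b else 0)"
    using orthonormalD[OF B(1) _ b] by (intro sum.cong) auto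
  also have "\<dots> = vec_inner R f b" using B b by simp
  finally show ?thesis
    using B b f by (subst vec_inner_diff_left[of _ R S]) (auto intro: orth_proj_in_l2_vec)
qed

lemma vec_inner_span_eq_0:
  assumes "B \<subseteq> l2_vec R S" "f \<in> l2_vec R S" "\<And>b. b \<in> B \<Longrightarrow> vec_inner R f b = 0"
    and "v \<in> vseq.span B"
  shows "vec_inner R f v = 0"
proof -
  have "vseq.subspace {v \<in> l2_vec R S. vec_inner R f v = 0}"
    using assms(2) vec_inner_commute[of R f 0]
    by (intro vseq.subspaceI)
      (auto intro: l2_vec_add l2_vec_scale l2_vec_zero
        simp: vec_inner_zero_left vec_inner_scale_right vec_inner_add_right[of _ R S])
  then show ?thesis
    using vseq.span_minimal[of B "{v \<in> l2_vec R S. vec_inner R f v = 0}"] assms by blast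
qed

text \<open>The residual is orthogonal to the projection, so its squared norm is that of
  \<open>f\<close> minus the inner product of the projection with \<open>f\<close>, which is the
  coefficient sum.\<close>

lemma orth_proj_norm:
  assumes B: "orthonormal R B" "finite B" "B \<subseteq> l2_vec R S" and f: "f \<in> l2_vec R S"
  shows "(vec_norm R (f - orth_proj R B f))\<^sup>2 = (vec_norm R f)\<^sup>2 - (\<Sum>b\<in>B. (cmod (vec_inner R f b))\<^sup>2)"
proof -
  let ?w = "orth_proj R B f"
  have w: "?w \<in> l2_vec R S" by (rule orth_proj_in_l2_vec[OF B(3)])
  have d: "f - ?w \<in> l2_vec R S" by (rule l2_vec_diff[OF f w])
  have "vec_inner R (f - ?w) (f - ?w) = vec_inner R (f - ?w) f - vec_inner R (f - ?w) ?w"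
    by (rule vec_inner_diff_right[OF f w d])
  also have "vec_inner R (f - ?w) ?w = 0"
    by (rule vec_inner_span_eq_0[OF B(3) d orth_proj_residual_base[OF B f] orth_proj_in_span])
  also have "vec_inner R (f - ?w) f = vec_inner R f f - vec_inner R ?w f"
    by (rule vec_inner_diff_left[OF f w f])
  also have "vec_inner R ?w f = (\<Sum>b\<in>B. vec_inner R f b * vec_inner R b f)"
    unfolding orth_proj_def using B f
    by (subst vec_inner_sum_left[of _ _ R S]) (auto intro: l2_vec_scale simp: vec_inner_scale_left)
  also have "\<dots> = of_real (\<Sum>b\<in>B. (cmod (vec_inner R f b))\<^sup>2)"
    unfolding of_real_sum by (intro sum.cong refl, subst (2) vec_inner_commute)
      (metis complex_norm_square)
  finally show ?thesis
    unfolding vec_inner_self_norm diff_zero by (simp only: of_real_diff[symmetric] of_real_eq_iff)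
qed

lemma bessel_ineq:
  assumes "orthonormal R B" "finite B" "B \<subseteq> l2_vec R S" "f \<in> l2_vec R S"
  shows "(\<Sum>b\<in>B. (cmod (vec_inner R f b))\<^sup>2) \<le> (vec_norm R f)\<^sup>2"
  using orth_proj_norm[OF assms] zero_le_power2[of "vec_norm R (f - orth_proj R B f)"] by linarith

text \<open>Split \<open>f - v\<close> into the residual of \<open>f\<close> and a vector of the
  span; by Pythagoras no \<open>v\<close> beats the projection.\<close>

lemma orth_proj_best_approx:
  assumes B: "orthonormal R B" "finite B" "B \<subseteq> l2_vec R S" and f: "f \<in> l2_vec R S"
    and v: "v \<in> vseq.span B"
  shows "(vec_norm R f)\<^sup>2 - (\<Sum>b\<in>B. (cmod (vec_inner R f b))\<^sup>2) \<le> (vec_norm R (f - v))\<^sup>2"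
proof -
  let ?w = "orth_proj R B f"
  have w: "?w \<in> l2_vec R S" by (rule orth_proj_in_l2_vec[OF B(3)])
  have d: "f - ?w \<in> l2_vec R S" by (rule l2_vec_diff[OF f w])
  have s: "?w - v \<in> vseq.span B" by (rule vseq.span_diff[OF orth_proj_in_span v])
  have "(vec_norm R ((f - ?w) + (?w - v)))\<^sup>2 = (vec_norm R (f - ?w))\<^sup>2 + (vec_norm R (?w - v))\<^sup>2"
    by (rule vec_norm_add_orthogonal[OF d span_l2_vec[OF B(3) s]
          vec_inner_span_eq_0[OF B(3) d orth_proj_residual_base[OF B f] s]])
  then show ?thesis using orth_proj_norm[OF B f] by simp
qed

text \<open>Each step adjoins the normalised residual of the new vector. A vector with zero residual
  already lies in the span and adds nothing, hence only an inequality of cardinalities.\<close>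

lemma gram_schmidt:
  assumes "finite G" "G \<subseteq> l2_vec R S"
  shows "\<exists>B. finite B \<and> B \<subseteq> l2_vec R S \<and> orthonormal R B \<and> card B \<le> card G \<and> G \<subseteq> vseq.span B"
  using assms
proof (induction G)
  case empty
  show ?case by (intro exI[of _ "{}"]) (simp add: orthonormal_def)
next
  case (insert f G)
  then obtain B where B: "orthonormal R B" "finite B" "B \<subseteq> l2_vec R S"
    and c: "card B \<le> card G" and G: "G \<subseteq> vseq.span B" by auto
  have f: "f \<in> l2_vec R S" using insert.prems by simp
  let ?w = "orth_proj R B f"
  let ?n = "vec_norm R (f - ?w)"
  have d: "f - ?w \<in> l2_vec R S" by (rule l2_vec_diff[OF f orth_proj_in_l2_vec[OF B(3)]])
  show ?case
  proof (cases "?n = 0")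
    case True
    then have "f = ?w" using vec_norm_eq_0D[OF d] by simp
    then have "f \<in> vseq.span B" using orth_proj_in_span by metis
    then show ?thesis using B c G insert.hyps by (intro exI[of _ B]) auto
  next
    case False
    define u where "u = vec_scale (of_real (1 / ?n)) (f - ?w)"
    have u: "u \<in> l2_vec R S" unfolding u_def by (rule l2_vec_scale[OF d])
    have ub: "vec_inner R u b = 0" if "b \<in> B" for b
      unfolding u_def vec_inner_scale_left using orth_proj_residual_base[OF B f that] by simp
    have "(vec_norm R u)\<^sup>2 = 1"
      unfolding u_def vec_norm_scale norm_of_real using False by (simp add: power_divide)
    then have uu: "vec_inner R u u = 1" by (simp only: vec_inner_self_norm) simp
    have bu: "vec_inner R b u = 0" if "b \<in> B" for b
      using ub[OF that] vec_inner_commute[of R b u] by simp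
    have "u \<notin> B" using ub uu by fastforce
    then have "orthonormal R (insert u B)"
      using orthonormalD[OF B(1)] ub bu uu unfolding orthonormal_def by auto
    moreover have "f \<in> vseq.span (insert u B)"
    proof -
      have "vec_scale (of_real ?n) u = f - ?w"
        using False by (simp add: u_def)
      then have "f = vec_scale (of_real ?n) u + ?w" by (metis diff_add_cancel)
      moreover have "?w \<in> vseq.span (insert u B)"
        using orth_proj_in_span vseq.span_mono[of B "insert u B"] by blast
      moreover have "vec_scale (of_real ?n) u \<in> vseq.span (insert u B)"
        by (intro vseq.span_scale vseq.span_base) simp
      ultimately show ?thesis using vseq.span_add by metis
    qed
    moreover have "G \<subseteq> vseq.span (insert u B)"
      using G vseq.span_mono[of B "insert u B"] by blast
    moreover have "card (insert u B) \<le> card (insert f G)"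
      using insert.hyps B c card_insert_le_m1[of "Suc (card B)" B u] by (simp add: card_insert_if)
    ultimately show ?thesis using B u by (intro exI[of _ "insert u B"]) simp
  qed
qed

text \<open>Double counting of squared coefficients between \<open>E\<close> and an orthonormal
  \<open>B\<close> whose span contains \<open>G\<close>: each \<open>e\<close> contributes at least
  \<open>1 - \<epsilon>\<close> by best approximation, each \<open>b\<close> at most 1 by
  Bessel.\<close>

lemma card_orthonormal_le_approx:
  assumes E: "orthonormal R E" "finite E" "E \<subseteq> l2_vec R S"
    and G: "finite G" "G \<subseteq> l2_vec R S"
    and approx: "\<And>e. e \<in> E \<Longrightarrow> \<exists>v\<in>vseq.span G. (vec_norm R (e - v))\<^sup>2 \<le> \<epsilon>"
  shows "real (card E) * (1 - \<epsilon>) \<le> real (card G)"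
proof -
  obtain B where B: "orthonormal R B" "finite B" "B \<subseteq> l2_vec R S"
    and c: "card B \<le> card G" and GB: "G \<subseteq> vseq.span B" using gram_schmidt[OF G] by blast
  have one: "(vec_norm R e)\<^sup>2 = 1" if "orthonormal R X" "e \<in> X" for X e
    using orthonormalD[OF that(1,2,2)] by (metis Re_complex_of_real one_complex.sel(1) vec_inner_self_norm)
  have "1 - \<epsilon> \<le> (\<Sum>b\<in>B. (cmod (vec_inner R e b))\<^sup>2)" if e: "e \<in> E" for e
  proof -
    obtain v where v: "v \<in> vseq.span G" "(vec_norm R (e - v))\<^sup>2 \<le> \<epsilon>" using approx[OF e] by blast
    have "v \<in> vseq.span B" using v(1) GB vseq.span_minimal vseq.subspace_span by blast
    from orth_proj_best_approx[OF B _ this, of e] show ?thesis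
      using v(2) one[OF E(1) e] e E(3) by force
  qed
  then have "real (card E) * (1 - \<epsilon>) \<le> (\<Sum>e\<in>E. \<Sum>b\<in>B. (cmod (vec_inner R e b))\<^sup>2)"
    using sum_bounded_below[of E "1 - \<epsilon>"] by simp
  also have "\<dots> = (\<Sum>b\<in>B. \<Sum>e\<in>E. (cmod (vec_inner R b e))\<^sup>2)"
    by (subst sum.swap, subst vec_inner_commute) simp
  also have "\<dots> \<le> (\<Sum>b\<in>B. 1)"
    using bessel_ineq[OF E] one[OF B(1)] B(3) by (intro sum_mono) force
  finally show ?thesis using c by simp
qed


section \<open>Frames are complete\<close>

text \<open>Adding to \<open>h\<close> the projection of \<open>f - h\<close> onto \<open>v\<close>
  stays in \<open>V\<close> and lowers the squared distance by the squared modulus of the inner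
  product over the squared norm of \<open>v\<close>. Near-minimality allows a gain of at most
  \<open>\<eta>\<close>.\<close>

lemma vec_inner_power2_le_of_min_dist:
  assumes V: "vseq.subspace V" "V \<subseteq> l2_vec R S" and f: "f \<in> l2_vec R S" and h: "h \<in> V" and v: "v \<in> V"
    and d: "\<And>w. w \<in> V \<Longrightarrow> d \<le> (vec_norm R (f - w))\<^sup>2" and "(vec_norm R (f - h))\<^sup>2 \<le> d + \<eta>"
  shows "(cmod (vec_inner R (f - h) v))\<^sup>2 \<le> \<eta> * (vec_norm R v)\<^sup>2"
proof (cases "vec_norm R v = 0")
  case True
  then have "v = 0" using vec_norm_eq_0D V v by blast
  then show ?thesis using True vec_inner_commute[of R "f - h" 0] by (simp add: vec_inner_zero_left)
next
  case False
  define n where "n = (vec_norm R v)\<^sup>2"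
  have n: "n > 0" using False by (simp add: n_def)
  define u where "u = f - h"
  \<comment> \<open>Coefficient of the projection of \<open>u\<close> onto \<open>v\<close>.\<close>
  define t where "t = vec_inner R u v / of_real n"
  have mem: "u \<in> l2_vec R S" "v \<in> l2_vec R S" "vec_scale t v \<in> l2_vec R S"
    using V f h v by (auto simp: u_def intro: l2_vec_diff l2_vec_scale)
  have "vec_inner R (u - vec_scale t v) v = 0"
    unfolding vec_inner_diff_left[OF mem(1,3,2)] vec_inner_scale_left vec_inner_self_norm
      n_def[symmetric] using n by (simp add: t_def)
  then have "vec_inner R (u - vec_scale t v) (vec_scale t v) = 0"
    by (simp add: vec_inner_scale_right)
  from vec_norm_add_orthogonal[OF l2_vec_diff[OF mem(1,3)] mem(3) this]
  have "(vec_norm R u)\<^sup>2 = (vec_norm R (u - vec_scale t v))\<^sup>2 + (vec_norm R (vec_scale t v))\<^sup>2"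
    by simp
  moreover have "(vec_norm R (vec_scale t v))\<^sup>2 = (cmod (vec_inner R u v))\<^sup>2 / n"
    unfolding vec_norm_scale n_def[symmetric] t_def norm_divide
    using n by (simp add: power_divide power2_eq_square)
  moreover have "d \<le> (vec_norm R (u - vec_scale t v))\<^sup>2"
    using d[OF vseq.subspace_add[OF V(1) h vseq.subspace_scale[OF V(1) v, of t]]]
    by (simp add: u_def diff_diff_eq)
  moreover have "(vec_norm R u)\<^sup>2 \<le> d + \<eta>"
    using assms by (simp add: u_def)
  ultimately have "(cmod (vec_inner R u v))\<^sup>2 / n \<le> \<eta>" by linarith
  then show ?thesis using n by (simp add: u_def n_def field_simps)
qed

text \<open>The upper frame bound carried over to the synthesis map: pair the vector with its own
  expansion, apply the frame bound to it, and absorb half of its squared norm.\<close>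

lemma frame_synthesis_bound:
  assumes "frame_bounds R (l2_vec R S) A B I F" "finite J" "J \<subseteq> I"
  shows "(vec_norm R (\<Sum>i\<in>J. vec_scale (c i) (F i)))\<^sup>2 \<le> B * (\<Sum>i\<in>J. (cmod (c i))\<^sup>2)"
proof -
  define v where "v = (\<Sum>i\<in>J. vec_scale (c i) (F i))"
  define x where "x = (vec_norm R v)\<^sup>2"
  have B: "B > 0" and F: "\<And>i. i \<in> J \<Longrightarrow> F i \<in> l2_vec R S"
    using assms by (auto simp: frame_bounds_def)
  have v: "v \<in> l2_vec R S"
    unfolding v_def by (intro l2_vec_sum l2_vec_scale F)
  have "(\<Sum>i\<in>J. (cmod (vec_inner R v (F i)))\<^sup>2) \<le> (\<Sum>\<^sub>\<infinity>i\<in>I. (cmod (vec_inner R v (F i)))\<^sup>2)"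
    using assms v by (intro finite_sum_le_infsum) (auto simp: frame_bounds_def)
  also have "\<dots> \<le> B * x" using assms(1) v by (auto simp: frame_bounds_def x_def)
  finally have up: "(\<Sum>i\<in>J. (cmod (vec_inner R v (F i)))\<^sup>2) \<le> B * x" .
  have "complex_of_real x = vec_inner R v v" by (simp only: vec_inner_self_norm x_def)
  also have "\<dots> = (\<Sum>i\<in>J. cnj (c i) * vec_inner R v (F i))"
    using vec_inner_sum_right[of J "\<lambda>i. vec_scale (c i) (F i)" R S v] F v
    by (simp add: vec_inner_scale_right l2_vec_scale flip: v_def)
  finally have "cmod (complex_of_real x) \<le> (\<Sum>i\<in>J. cmod (c i) * cmod (vec_inner R v (F i)))"
    using norm_sum[of "\<lambda>i. cnj (c i) * vec_inner R v (F i)" J] by (simp add: norm_mult)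
  then have x: "x \<le> (\<Sum>i\<in>J. cmod (c i) * cmod (vec_inner R v (F i)))"
    by (simp add: x_def del: of_real_power)
  \<comment> \<open>The mean inequality is weighted by \<open>B\<close> so that the frame bound
    turns the second sum into at most \<open>x\<close>.\<close>
  also have "\<dots> \<le> (\<Sum>i\<in>J. (B * (cmod (c i))\<^sup>2 + (cmod (vec_inner R v (F i)))\<^sup>2 / B) / 2)"
  proof (rule sum_mono)
    fix i
    have "0 \<le> (B * cmod (c i) - cmod (vec_inner R v (F i)))\<^sup>2 / B" using B by simp
    then show "cmod (c i) * cmod (vec_inner R v (F i)) \<le>
        (B * (cmod (c i))\<^sup>2 + (cmod (vec_inner R v (F i)))\<^sup>2 / B) / 2"
      using B by (simp add: power2_diff power2_eq_square field_simps)
  qed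
  also have "\<dots> = (B * (\<Sum>i\<in>J. (cmod (c i))\<^sup>2) + (\<Sum>i\<in>J. (cmod (vec_inner R v (F i)))\<^sup>2) / B) / 2"
    by (simp add: sum_distrib_left sum.distrib flip: sum_divide_distrib)
  also have "\<dots> \<le> (B * (\<Sum>i\<in>J. (cmod (c i))\<^sup>2) + x) / 2"
    using up B by (simp add: field_simps)
  finally show ?thesis by (simp add: x_def v_def)
qed

text \<open>
  For a near-minimizer \<open>h\<close> of the distance from \<open>f\<close> to the span, \<open>f - h\<close> is almost orthogonal to
  the span, so the lower frame bound forces it to be small; no completeness of the space is needed.
\<close>

lemma frame_imp_complete:
  assumes fr: "frame_bounds R (l2_vec R S) A B I F"
  shows "is_complete R (l2_vec R S) I F"
proof -
  define V where "V = vseq.span (F ` I)"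
  have AB: "0 < A" "0 < B" and FI: "countable I" "F ` I \<subseteq> l2_vec R S"
    using fr by (auto simp: frame_bounds_def)
  have V: "vseq.subspace V" "V \<subseteq> l2_vec R S"
    using span_l2_vec[OF FI(2)] by (auto simp: V_def)
  have "f \<in> norm_closure R (l2_vec R S) V" if f: "f \<in> l2_vec R S" for f
  proof -
    define D where "D = (\<lambda>h. (vec_norm R (f - h))\<^sup>2) ` V"
    have D: "bdd_below D" "D \<noteq> {}"
      using vseq.subspace_0[OF V(1)] by (auto simp: D_def intro!: bdd_belowI[of _ 0])
    have Inf_le: "Inf D \<le> (vec_norm R (f - w))\<^sup>2" if "w \<in> V" for w
      using D that by (auto simp: D_def intro: cInf_lower)
    have near: "\<exists>h\<in>V. (vec_norm R (f - h))\<^sup>2 < x" if "Inf D < x" for x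
      using cInf_lessD[OF D(2) that] by (auto simp: D_def)
    have small: "A * Inf D \<le> \<eta> * B" if "\<eta> > 0" for \<eta>
    proof -
      have "Inf D < Inf D + \<eta>" using that by simp
      then obtain h where h: "h \<in> V" "(vec_norm R (f - h))\<^sup>2 < Inf D + \<eta>"
        using near by blast
      define u where "u = f - h"
      have u: "u \<in> l2_vec R S" using f h V by (auto simp: u_def intro: l2_vec_diff)
      have fin: "(\<Sum>i\<in>J. (cmod (vec_inner R u (F i)))\<^sup>2) \<le> \<eta> * B" if J: "finite J" "J \<subseteq> I" for J
      proof -
        define C where "C = (\<Sum>i\<in>J. (cmod (vec_inner R u (F i)))\<^sup>2)"
        \<comment> \<open>Synthesising the analysis coefficients of \<open>u\<close> makes
          \<open>vec_inner R u v\<close> equal to \<open>C\<close>; the estimate is then quadratic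
          in \<open>C\<close> on the left and linear on the right.\<close>
        define v where "v = (\<Sum>i\<in>J. vec_scale (vec_inner R u (F i)) (F i))"
        have v: "v \<in> V" unfolding v_def V_def using J
          by (intro vseq.span_sum vseq.span_scale vseq.span_base) auto
        have "vec_inner R u v = (\<Sum>i\<in>J. cnj (vec_inner R u (F i)) * vec_inner R u (F i))"
          unfolding v_def using J FI u
          by (subst vec_inner_sum_right[of _ _ R S]) (auto simp: vec_inner_scale_right intro!: l2_vec_scale)
        also have "\<dots> = of_real C"
          unfolding C_def of_real_sum by (intro sum.cong refl) (metis complex_norm_square mult.commute)
        finally have "C\<^sup>2 \<le> \<eta> * (vec_norm R v)\<^sup>2"
          using vec_inner_power2_le_of_min_dist[OF V f h(1) v Inf_le less_imp_le[OF h(2)]]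
          by (simp add: u_def)
        also have "\<dots> \<le> \<eta> * (B * C)"
          using frame_synthesis_bound[OF fr J] \<open>\<eta> > 0\<close> by (simp add: v_def C_def)
        finally have *: "C * C \<le> (\<eta> * B) * C" by (simp add: power2_eq_square ac_simps)
        have "C \<le> \<eta> * B"
        proof (cases "C > 0")
          case True
          then show ?thesis using * mult_right_le_imp_le by blast
        next
          case False
          then show ?thesis using AB \<open>\<eta> > 0\<close> by (smt (verit) mult_pos_pos)
        qed
        then show ?thesis by (simp add: C_def)
      qed
      have "A * Inf D \<le> A * (vec_norm R u)\<^sup>2" using Inf_le[OF h(1)] AB by (simp add: u_def)
      also have "\<dots> \<le> (\<Sum>\<^sub>\<infinity>i\<in>I. (cmod (vec_inner R u (F i)))\<^sup>2)"
        using fr u by (auto simp: frame_bounds_def)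
      also have "\<dots> \<le> \<eta> * B"
        using fr u fin by (intro infsum_le_finite_sums) (auto simp: frame_bounds_def)
      finally show ?thesis .
    qed
    have "Inf D \<le> 0"
    proof (rule ccontr)
      assume "\<not> Inf D \<le> 0"
      then have pos: "A * Inf D > 0" using AB by simp
      \<comment> \<open>With this \<open>\<eta>\<close> the bound reads
        \<open>A * Inf D \<le> A * Inf D / 2\<close>.\<close>
      then have "A * Inf D \<le> A * Inf D / (2 * B) * B" using AB by (intro small) simp
      then show False using AB pos by (simp add: zero_less_mult_iff)
    qed
    have "\<exists>h\<in>V. vec_norm R (f - h) < \<epsilon>" if "\<epsilon> > 0" for \<epsilon>
    proof -
      have "Inf D < \<epsilon>\<^sup>2" using \<open>Inf D \<le> 0\<close> that by (smt (verit) zero_less_power)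
      then obtain h where "h \<in> V" "(vec_norm R (f - h))\<^sup>2 < \<epsilon>\<^sup>2"
        using near by blast
      then show ?thesis using that by (meson less_imp_le power_less_imp_less_base)
    qed
    then show ?thesis using f by (auto simp: norm_closure_def)
  qed
  then show ?thesis using FI by (auto simp: is_complete_def norm_closure_def V_def)
qed

section \<open>Completeness bounds the class sizes\<close>

definition delta :: "nat \<Rightarrow> int \<Rightarrow> vseq" where
  "delta r x = (\<lambda>r' j. if r' = r \<and> j = x then 1 else 0)"

lemma delta_in_l2_vec: "r < R \<Longrightarrow> x \<in> S \<Longrightarrow> delta r x \<in> l2_vec R S"
proof -
  assume *: "r < R" "x \<in> S"
  have "(\<lambda>j. (cmod (delta r x r' j))\<^sup>2) summable_on UNIV" for r'
    by (rule has_sum_imp_summable[OF has_sum_finite_neutralI[of "{x}"]]) (auto simp: delta_def)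
  then show ?thesis using * by (auto simp: l2_vec_def l2_def delta_def)
qed

lemma vec_inner_delta_right: "r < R \<Longrightarrow> vec_inner R f (delta r x) = f r x"
proof -
  assume "r < R"
  have "l2_inner (f s) (delta r x s) = (if s = r then f r x else 0)" for s
    unfolding l2_inner_def
    by (rule infsumI, rule has_sum_finite_neutralI[of "{x}"]) (auto simp: delta_def)
  then show ?thesis using \<open>r < R\<close> by (simp add: vec_inner_def)
qed

lemma delta_eq_iff: "delta r x = delta s y \<longleftrightarrow> r = s \<and> x = y"
  by (auto simp: delta_def fun_eq_iff split: if_splits)

lemma orthonormal_delta:
  assumes "\<And>r x. (r, x) \<in> X \<Longrightarrow> r < R"
  shows "orthonormal R ((\<lambda>(r, x). delta r x) ` X)"
  using assms by (auto simp: orthonormal_def vec_inner_delta_right delta_eq_iff) (auto simp: delta_def)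

text \<open>Translation by \<open>k\<close> followed by restriction to \<open>X\<close>. One
  operator serves two uses: \<open>X = UNIV\<close> gives the plain translation, a residue class
  isolates the part of a vector on that class.\<close>

definition cut_shift :: "int set \<Rightarrow> int \<Rightarrow> vseq \<Rightarrow> vseq" where
  "cut_shift X k f = (\<lambda>r j. if j \<in> X then f r (j - k) else 0)"

lemma cut_shift_linear:
  "cut_shift X k 0 = 0"
  "cut_shift X k (f + h) = cut_shift X k f + cut_shift X k h"
  "cut_shift X k (f - h) = cut_shift X k f - cut_shift X k h"
  "cut_shift X k (vec_scale c f) = vec_scale c (cut_shift X k f)"
  by (auto simp: cut_shift_def vec_scale_def fun_eq_iff)

lemma summable_cut_shift:
  assumes "f \<in> l2_vec R S" "r < R"
  shows "(\<lambda>j. (cmod (f r (j - k)))\<^sup>2) summable_on UNIV"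
    "(\<Sum>\<^sub>\<infinity>j. (cmod (f r (j - k)))\<^sup>2) = (\<Sum>\<^sub>\<infinity>j. (cmod (f r j))\<^sup>2)"
    "(\<lambda>j. (cmod (cut_shift X k f r j))\<^sup>2) summable_on UNIV"
proof -
  have bij: "bij_betw (\<lambda>j::int. j - k) UNIV UNIV"
    by (rule bij_betwI[where g = "\<lambda>j. j + k"]) auto
  have *: "(\<lambda>j. (cmod (f r j))\<^sup>2) summable_on UNIV"
    using l2_vecD[OF assms] by (simp add: l2_def)
  then show 1: "(\<lambda>j. (cmod (f r (j - k)))\<^sup>2) summable_on UNIV"
    using summable_on_reindex_bij_betw[OF bij, of "\<lambda>j. (cmod (f r j))\<^sup>2"] by simp
  show "(\<Sum>\<^sub>\<infinity>j. (cmod (f r (j - k)))\<^sup>2) = (\<Sum>\<^sub>\<infinity>j. (cmod (f r j))\<^sup>2)"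
    using infsum_reindex_bij_betw[OF bij, of "\<lambda>j. (cmod (f r j))\<^sup>2"] by simp
  show "(\<lambda>j. (cmod (cut_shift X k f r j))\<^sup>2) summable_on UNIV"
    by (rule summable_on_comparison_test[OF 1]) (auto simp: cut_shift_def)
qed

lemma cut_shift_in_l2_vec:
  assumes "f \<in> l2_vec R S" "\<And>j. j \<in> S \<Longrightarrow> j + k \<in> S"
  shows "cut_shift X k f \<in> l2_vec R S"
proof -
  have "cut_shift X k f r j = 0" if "j \<notin> S" "r < R" for r j
    using that assms(2)[of "j - k"] assms(1) by (auto simp: l2_vec_def l2_def cut_shift_def)
  moreover have "cut_shift X k f r j = 0" if "r \<ge> R" for r j
    using assms(1) that by (simp add: l2_vec_def cut_shift_def)
  ultimately show ?thesis
    using summable_cut_shift(3)[OF assms(1)] by (auto simp: l2_vec_def l2_def)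
qed

text \<open>Translation preserves the norm and restriction cannot increase it, so an approximation
  of one unit vector can be moved to its translates with the same error.\<close>

lemma vec_norm_cut_shift_le:
  assumes "f \<in> l2_vec R S"
  shows "(vec_norm R (cut_shift X k f))\<^sup>2 \<le> (vec_norm R f)\<^sup>2"
  unfolding vec_norm_power2
proof (rule sum_mono)
  fix r assume "r \<in> {..<R}"
  then have r: "r < R" by simp
  have "(\<Sum>\<^sub>\<infinity>j. (cmod (cut_shift X k f r j))\<^sup>2) \<le> (\<Sum>\<^sub>\<infinity>j. (cmod (f r (j - k)))\<^sup>2)"
    using summable_cut_shift[OF assms r] by (intro infsum_mono) (auto simp: cut_shift_def)
  then show "(\<Sum>\<^sub>\<infinity>j. (cmod (cut_shift X k f r j))\<^sup>2) \<le> (\<Sum>\<^sub>\<infinity>j. (cmod (f r j))\<^sup>2)"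
    using summable_cut_shift(2)[OF assms r] by simp
qed


section \<open>Gabor systems on residue classes\<close>

lemma gabor_in_l2_vec:
  assumes "periodic_set N S" "g l \<in> l2_vec R S"
  shows "gabor g M N (m, n, l) \<in> l2_vec R S"
proof -
  have s: "cut_shift UNIV (n * int N) (g l) \<in> l2_vec R S"
    using assms by (intro cut_shift_in_l2_vec) (auto simp: periodic_set_def)
  \<comment> \<open>Membership depends only on the moduli, which modulation preserves, so the plain
    translate decides.\<close>
  have iff: "f \<in> l2_vec R S \<longleftrightarrow> (\<forall>r<R. (\<lambda>j. (cmod (f r j))\<^sup>2) summable_on UNIV) \<and>
      (\<forall>r j. R \<le> r \<or> j \<notin> S \<longrightarrow> cmod (f r j) = 0)" for f
    unfolding l2_vec_def l2_def by (auto simp: fun_eq_iff not_le) (meson not_le)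
  have c: "cmod (exp (2 * pi * \<i> * of_nat m * of_int j / of_nat M)) = 1" for j :: int
    by simp
  have "cmod (gabor g M N (m, n, l) r j) = cmod (cut_shift UNIV (n * int N) (g l) r j)" for r j
    by (simp only: gabor_def modulation_def translation_def cut_shift_def norm_mult c
        prod.case UNIV_I if_True mult_1_left)
  then show ?thesis using s by (simp only: iff)
qed

text \<open>Modulations are constant on classes modulo \<open>M\<close>: the discarded multiple of
  \<open>M\<close> changes the exponent by an integer multiple of
  \<open>2 * pi * \<i>\<close>.\<close>

lemma exp_2pi_i_mod:
  assumes "M > 0"
  shows "exp (2 * pi * \<i> * of_nat m * of_int (x mod int M) / of_nat M) =
    exp (2 * pi * \<i> * of_nat m * of_int x / of_nat M)"
proof -
  have "complex_of_int x = of_int (x div int M) * of_nat M + of_int (x mod int M)"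
    by (metis div_mult_mod_eq of_int_add of_int_mult of_int_of_nat_eq)
  then have "2 * pi * \<i> * of_nat m * of_int x / of_nat M =
      2 * pi * \<i> * of_nat m * of_int (x mod int M) / of_nat M +
      (2 * of_int (int m * (x div int M)) * pi) * \<i>"
    using assms by (simp add: field_simps)
  then show ?thesis
    by (simp only: exp_add exp_integer_2pi[OF Ints_of_int] mult_1_right)
qed

lemma sum_vseq_apply: "(\<Sum>i\<in>A. f i) r x = (\<Sum>i\<in>A. (f i :: vseq) r x)"
  by (induction A rule: infinite_finite_induct) auto

text \<open>
  The translate \<open>T\<^bsub>nN\<^esub> g\<^sub>l\<close> cut down to a single class modulo \<open>M\<close>; on such a class every
  modulation acts as a scalar.
\<close>

definition pieces ::
    "(nat \<Rightarrow> vseq) \<Rightarrow> nat \<Rightarrow> nat \<Rightarrow> nat \<Rightarrow> nat \<Rightarrow> nat \<Rightarrow> int \<Rightarrow> int \<Rightarrow> vseq set" where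
  "pieces g L M N d j a b =
    (\<lambda>(i, n, l). cut_shift {x. x mod int M = i} (n * int N) (g l)) `
      ({i. 0 \<le> i \<and> i < int M \<and> i mod int d = int j} \<times> {a..b} \<times> {..<L})"

text \<open>The residues are \<open>j + d * s\<close> with \<open>s < q\<close>; this is the source
  of the factor \<open>q\<close> in the dimension count.\<close>

lemma card_residues_le:
  assumes "j < d" "0 < q"
  shows "finite {i. 0 \<le> i \<and> i < int (q * d) \<and> i mod int d = int j}"
    "card {i. 0 \<le> i \<and> i < int (q * d) \<and> i mod int d = int j} \<le> q"
proof -
  show "finite {i. 0 \<le> i \<and> i < int (q * d) \<and> i mod int d = int j}"
    by (rule finite_subset[of _ "{0..<int (q * d)}"]) auto
  have "i \<in> (\<lambda>s. int j + int d * int s) ` {..<q}"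
    if i: "0 \<le> i" "i < int (q * d)" "i mod int d = int j" for i
  proof -
    have d: "0 < int d" using assms by simp
    have i': "i = int j + int d * (i div int d)" by (metis i(3) mod_mult_div_eq)
    have "0 \<le> i div int d" using i d by (simp add: pos_imp_zdiv_nonneg_iff)
    moreover have "i div int d < int q"
    proof (rule ccontr)
      assume "\<not> i div int d < int q"
      then have "int d * int q \<le> int d * (i div int d)" by (intro mult_left_mono) auto
      also have "\<dots> \<le> i" using i' by linarith
      finally show False using i(2) by (simp add: mult.commute)
    qed
    ultimately show ?thesis using i' by (intro image_eqI[of _ _ "nat (i div int d)"]) auto
  qed
  then have "{i. 0 \<le> i \<and> i < int (q * d) \<and> i mod int d = int j} \<subseteq> (\<lambda>s. int j + int d * int s) ` {..<q}"
    by auto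
  then show "card {i. 0 \<le> i \<and> i < int (q * d) \<and> i mod int d = int j} \<le> q"
    using surj_card_le[OF finite_lessThan] by fastforce
qed

lemma pieces_finite_card:
  assumes "j < d" "0 < q" "M = q * d"
  shows "finite (pieces g L M N d j a b)" "card (pieces g L M N d j a b) \<le> q * nat (b - a + 1) * L"
proof -
  let ?I = "{i. 0 \<le> i \<and> i < int M \<and> i mod int d = int j}"
  note I = card_residues_le[OF assms(1,2), folded assms(3)]
  show "finite (pieces g L M N d j a b)" unfolding pieces_def using I by simp
  have "card (pieces g L M N d j a b) \<le> card (?I \<times> {a..b} \<times> {..<L})"
    unfolding pieces_def using I by (intro card_image_le) simp
  also have "\<dots> \<le> q * nat (b - a + 1) * L"
    using I(2) by (simp add: card_cartesian_product mult_le_mono)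
  finally show "card (pieces g L M N d j a b) \<le> q * nat (b - a + 1) * L" .
qed

lemma pieces_in_l2_vec:
  assumes "periodic_set N S" "\<And>l. l < L \<Longrightarrow> g l \<in> l2_vec R S"
  shows "pieces g L M N d j a b \<subseteq> l2_vec R S"
  using assms by (auto simp: pieces_def periodic_set_def intro!: cut_shift_in_l2_vec)

lemma pieces_mono: "a' \<le> a \<Longrightarrow> b \<le> b' \<Longrightarrow> pieces g L M N d j a b \<subseteq> pieces g L M N d j a' b'"
  unfolding pieces_def by (intro image_mono Sigma_mono) auto

text \<open>As \<open>d\<close> divides \<open>M\<close>, the class of \<open>j\<close> modulo
  \<open>d\<close> is a disjoint union of classes modulo \<open>M\<close>, on each of which the
  modulation is a scalar. The index \<open>m\<close> therefore adds no dimensions.\<close>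

lemma cut_shift_gabor:
  assumes "M > 0" "d dvd M" "l < L"
  shows "cut_shift {x. x mod int d = int j} (n0 * int N) (gabor g M N (m, n, l))
    \<in> vseq.span (pieces g L M N d j (n0 + n) (n0 + n))"
proof -
  let ?I = "{i. 0 \<le> i \<and> i < int M \<and> i mod int d = int j}"
  define e where "e x = exp (2 * pi * \<i> * of_nat m * of_int x / of_nat M)" for x :: int
  have e_mod: "e (x - n0 * int N) = e (x mod int M - n0 * int N)" for x
  proof -
    have "e z = e (z mod int M)" for z
      by (simp only: e_def exp_2pi_i_mod[OF assms(1)])
    then show ?thesis by (metis mod_diff_left_eq)
  qed
  have fin: "finite ?I" by (rule finite_subset[of _ "{0..<int M}"]) auto
  have mem: "x mod int M \<in> ?I \<longleftrightarrow> x mod int d = int j" for x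
    using assms by (simp add: mod_mod_cancel)
  \<comment> \<open>The scalar is taken at \<open>i - n0 * int N\<close> because the modulation acts
    before the shift by \<open>n0 * int N\<close>.\<close>
  have "cut_shift {x. x mod int d = int j} (n0 * int N) (gabor g M N (m, n, l)) =
    (\<Sum>i\<in>?I. vec_scale (e (i - n0 * int N)) (cut_shift {x. x mod int M = i} ((n0 + n) * int N) (g l)))"
    (is "?lhs = ?rhs")
  proof (intro ext)
    fix r x
    have "?rhs r x = (\<Sum>i\<in>?I. if x mod int M = i then e (i - n0 * int N) * g l r (x - (n0 + n) * int N) else 0)"
      unfolding sum_vseq_apply by (intro sum.cong) (auto simp: vec_scale_def cut_shift_def)
    also have "\<dots> = (if x mod int M \<in> ?I then e (x mod int M - n0 * int N) * g l r (x - (n0 + n) * int N) else 0)"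
      by (rule sum.delta'[OF fin])
    also have "\<dots> = (if x mod int d = int j then e (x - n0 * int N) * g l r (x - (n0 + n) * int N) else 0)"
      by (simp only: mem e_mod[of x])
    also have "\<dots> = ?lhs r x"
      by (simp add: cut_shift_def gabor_def modulation_def translation_def e_def diff_diff_eq distrib_right)
    finally show "?lhs r x = ?rhs r x" by simp
  qed
  also have "\<dots> \<in> vseq.span (pieces g L M N d j (n0 + n) (n0 + n))"
  proof (intro vseq.span_sum vseq.span_scale vseq.span_base)
    fix i assume "i \<in> ?I"
    then show "cut_shift {x. x mod int M = i} ((n0 + n) * int N) (g l) \<in> pieces g L M N d j (n0 + n) (n0 + n)"
      unfolding pieces_def using assms(3) by (intro image_eqI[of _ _ "(i, n0 + n, l)"]) auto
  qed
  finally show ?thesis .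
qed

text \<open>A vector of the span involves finitely many translates, and shifting by
  \<open>n0\<close> only moves their window. The vectors admitting a radius \<open>B\<close>
  independent of \<open>n0\<close> form a subspace containing the system.\<close>

lemma cut_shift_span_gabor:
  assumes "M > 0" "d dvd M" "v \<in> vseq.span (gabor g M N ` gabor_index L M)"
  shows "\<exists>B::nat. \<forall>n0. cut_shift {x. x mod int d = int j} (n0 * int N) v
    \<in> vseq.span (pieces g L M N d j (n0 - int B) (n0 + int B))"
proof -
  let ?cs = "\<lambda>n0. cut_shift {x. x mod int d = int j} (n0 * int N)"
  define Q where "Q B = (\<lambda>n0. vseq.span (pieces g L M N d j (n0 - int B) (n0 + int B)))" for B
  have mono: "Q B n0 \<subseteq> Q B' n0" if "B \<le> B'" for B B' n0
    unfolding Q_def using that by (intro vseq.span_mono pieces_mono) auto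
  define Z where "Z = {v. \<exists>B. \<forall>n0. ?cs n0 v \<in> Q B n0}"
  have "vseq.subspace Z"
  proof (rule vseq.subspaceI)
    show "0 \<in> Z" by (auto simp: Z_def Q_def cut_shift_linear vseq.span_zero)
  next
    fix v w assume "v \<in> Z" "w \<in> Z"
    then obtain B C where "\<And>n0. ?cs n0 v \<in> Q B n0" "\<And>n0. ?cs n0 w \<in> Q C n0"
      by (auto simp: Z_def)
    then have "?cs n0 v \<in> Q (max B C) n0" "?cs n0 w \<in> Q (max B C) n0" for n0
      using mono[of B "max B C" n0] mono[of C "max B C" n0] by auto
    then have "?cs n0 (v + w) \<in> Q (max B C) n0" for n0
      unfolding cut_shift_linear Q_def by (intro vseq.span_add)
    then show "v + w \<in> Z" by (auto simp: Z_def)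
  next
    fix c v assume "v \<in> Z"
    then show "vec_scale c v \<in> Z"
      by (auto simp: Z_def Q_def cut_shift_linear intro: vseq.span_scale)
  qed
  moreover have "gabor g M N ` gabor_index L M \<subseteq> Z"
  proof (clarsimp simp: gabor_index_def)
    fix m l :: nat and n :: int assume l: "l < L"
    have "vseq.span (pieces g L M N d j (n0 + n) (n0 + n)) \<subseteq> Q (nat \<bar>n\<bar>) n0" for n0
      unfolding Q_def by (intro vseq.span_mono pieces_mono) auto
    then show "gabor g M N (m, n, l) \<in> Z"
      unfolding Z_def using cut_shift_gabor[OF assms(1,2) l] by blast
  qed
  ultimately have "v \<in> Z" using assms(3) vseq.span_minimal by blast
  then show ?thesis by (auto simp: Z_def Q_def)
qed

section \<open>Separation of lattice points and the dimension count\<close>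

lemma cut_shift_delta:
  assumes "x + k \<in> X"
  shows "cut_shift X k (delta r x) = delta r (x + k)"
  using assms by (auto simp: cut_shift_def delta_def fun_eq_iff)

text \<open>After cancelling \<open>d\<close>, \<open>p\<close> divides \<open>(k - k') * q\<close>,
  hence \<open>k - k'\<close> by coprimality; both numbers are below \<open>p\<close>, so they
  agree.\<close>

lemma inj_lattice_points:
  fixes d p q :: nat
  assumes "0 < d" "coprime p q" "0 < p"
    and eq: "int k * int (q * d) + n * int (p * d) = int k' * int (q * d) + n' * int (p * d)"
    and "k < p" "k' < p"
  shows "k = k' \<and> n = n'"
proof -
  have "int d * (int k * int q + n * int p) = int d * (int k' * int q + n' * int p)"
    using eq by (simp add: algebra_simps)
  then have eq': "int k * int q + n * int p = int k' * int q + n' * int p"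
    using assms(1) by simp
  then have "(int k - int k') * int q = int p * (n' - n)" by (simp add: algebra_simps)
  then have "int p dvd (int k - int k') * int q" by simp
  then have "int p dvd int k - int k'"
    using assms(2) by (simp add: coprime_dvd_mult_left_iff)
  then have "k = k'"
    using dvd_imp_le_int[of "int k - int k'" "int p"] assms(5,6) by fastforce
  then show ?thesis using eq' assms(3) by simp
qed


text \<open>
  The vectors \<open>\<delta>\<close> at the \<open>W\<close> translates \<open>j + kM + nN\<close>, \<open>0 \<le> n < W\<close>, number \<open>R * card K * W\<close>, and they
  are uniformly close to the span of only \<open>q L (W + 2 B)\<close> pieces, with \<open>B\<close> independent of \<open>W\<close>.
\<close>

lemma complete_gabor_imp_card_le:
  fixes p q d :: nat
  assumes comp: "is_complete R (l2_vec R S) (gabor_index L M) (gabor g M N)"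
    and g: "\<And>l. l < L \<Longrightarrow> g l \<in> l2_vec R S" and per: "periodic_set N S"
    and MN: "M = q * d" "N = p * d" and pos: "0 < d" "0 < p" "0 < q" and cop: "coprime p q"
    and j: "j < d"
  shows "R * card (K_set p M S (int j)) \<le> q * L"
proof (rule ccontr)
  define K where "K = K_set p M S (int j)"
  define pt where "pt k n = int j + int k * int M + n * int N" for k n
  define X where "X = {x. x mod int d = int j}"
  define c where "c = R * card K"
  assume "\<not> R * card (K_set p M S (int j)) \<le> q * L"
  then have c: "q * L + 1 \<le> c" by (simp add: c_def K_def)
  have K: "finite K" "\<And>k. k \<in> K \<Longrightarrow> k < p" by (auto simp: K_def K_set_def)
  have ptS: "pt k n \<in> S" if "k \<in> K" for k n
    using that per by (auto simp: K_def K_set_def pt_def periodic_set_def)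
  have ptX: "pt k n \<in> X" for k n
    using j by (simp add: pt_def X_def MN mod_add_eq[symmetric] mod_mult_right_eq[symmetric])
  define G where "G = pieces g L M N d j"
  have GU: "G a b \<subseteq> l2_vec R S" for a b unfolding G_def by (rule pieces_in_l2_vec[OF per g])
  have Mpos: "0 < M" "d dvd M" using MN pos by auto
  \<comment> \<open>One radius \<open>B\<close> works for all \<open>n\<close> at once; this makes
    the loss \<open>2 * B\<close> negligible against a long window.\<close>
  define close where "close \<epsilon> k r B \<longleftrightarrow> (\<forall>n. \<exists>u\<in>vseq.span (G (n - int B) (n + int B)).
      (vec_norm R (delta r (pt k n) - u))\<^sup>2 \<le> \<epsilon>)" for \<epsilon> k r and B :: nat
  have close_mono: "close \<epsilon> k r C" if "close \<epsilon> k r B" "B \<le> C" for \<epsilon> k r B C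
  proof -
    have "vseq.span (G (n - int B) (n + int B)) \<subseteq> vseq.span (G (n - int C) (n + int C))" for n
      unfolding G_def using that(2) by (intro vseq.span_mono pieces_mono) auto
    then show ?thesis using that(1) unfolding close_def by blast
  qed
  have "\<exists>B. close \<epsilon> k r B" if "\<epsilon> > 0" "k \<in> K" "r < R" for \<epsilon> k r
  proof -
    have e: "delta r (pt k 0) \<in> l2_vec R S" by (intro delta_in_l2_vec ptS that)
    then have "delta r (pt k 0) \<in> norm_closure R (l2_vec R S) (vseq.span (gabor g M N ` gabor_index L M))"
      using comp by (simp add: is_complete_def)
    moreover have "sqrt \<epsilon> > 0" using that(1) by simp
    ultimately obtain v where v: "v \<in> vseq.span (gabor g M N ` gabor_index L M)"
      "vec_norm R (delta r (pt k 0) - v) < sqrt \<epsilon>"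
      unfolding norm_closure_def by blast
    have vU: "v \<in> l2_vec R S"
      using v(1) comp span_l2_vec by (auto simp: is_complete_def)
    have "(vec_norm R (delta r (pt k 0) - v))\<^sup>2 \<le> (sqrt \<epsilon>)\<^sup>2"
      using v(2) vec_norm_nonneg by (intro power_mono) auto
    then have near: "(vec_norm R (delta r (pt k 0) - v))\<^sup>2 \<le> \<epsilon>" using that(1) by simp
    obtain B where B: "\<And>n. cut_shift X (n * int N) v \<in> vseq.span (G (n - int B) (n + int B))"
      unfolding X_def G_def using cut_shift_span_gabor[OF Mpos v(1)] by blast
    have "(vec_norm R (delta r (pt k n) - cut_shift X (n * int N) v))\<^sup>2 \<le> \<epsilon>" for n
    proof -
      \<comment> \<open>The unit vector at \<open>n\<close> is the shifted one at 0, so the equally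
        shifted \<open>v\<close> approximates it.\<close>
      have "delta r (pt k n) = cut_shift X (n * int N) (delta r (pt k 0))"
        using ptX[of k n] by (subst cut_shift_delta) (auto simp: pt_def)
      then have "delta r (pt k n) - cut_shift X (n * int N) v = cut_shift X (n * int N) (delta r (pt k 0) - v)"
        by (simp add: cut_shift_linear)
      then show ?thesis
        using vec_norm_cut_shift_le[OF l2_vec_diff[OF e vU], of X "n * int N"] near by simp
    qed
    then show ?thesis unfolding close_def using B by blast
  qed
  then have ex: "\<forall>\<epsilon> k r. \<exists>B. \<epsilon> > 0 \<and> k \<in> K \<and> r < R \<longrightarrow> close \<epsilon> k r B" by blast
  then obtain b where b: "\<And>\<epsilon> k r. \<epsilon> > 0 \<Longrightarrow> k \<in> K \<Longrightarrow> r < R \<Longrightarrow> close \<epsilon> k r (b \<epsilon> k r)"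
    by metis
  \<comment> \<open>As \<open>c \<ge> q * L + 1\<close>, this leaves
    \<open>c * (1 - \<epsilon>) = c - 1 / 2\<close>, still above \<open>q * L\<close> by at least
    one half.\<close>
  define \<epsilon> :: real where "\<epsilon> = 1 / (2 * real c)"
  have \<epsilon>: "\<epsilon> > 0" using c by (simp add: \<epsilon>_def)
  define B where "B = (\<Sum>(k, r)\<in>K \<times> {..<R}. b \<epsilon> k r)"
  have closeB: "close \<epsilon> k r B" if "k \<in> K" "r < R" for k r
  proof (rule close_mono[OF b[OF \<epsilon> that]])
    show "b \<epsilon> k r \<le> B"
      unfolding B_def using member_le_sum[of "(k, r)" "K \<times> {..<R}" "\<lambda>(k, r). b \<epsilon> k r"] that K by auto
  qed
  have window: "real (c * W) * (1 - \<epsilon>) \<le> real (q * (W + 2 * B) * L)" if W: "W \<ge> 1" for W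
  proof -
    define P where "P = (\<lambda>(k, n, r). (r, pt k (int n))) ` (K \<times> {..<W} \<times> {..<R})"
    define E where "E = (\<lambda>(r, x). delta r x) ` P"
    have fin: "finite P" unfolding P_def using K by simp
    have "inj_on (\<lambda>(k, n, r). (r, pt k (int n))) (K \<times> {..<W} \<times> {..<R})"
      using inj_lattice_points[OF pos(1) cop pos(2)] K(2)
      by (auto intro!: inj_onI simp: pt_def MN simp del: of_nat_mult) fastforce+
    then have cP: "card P = c * W"
      unfolding P_def by (subst card_image) (simp_all add: card_cartesian_product c_def ac_simps)
    have inj: "inj (\<lambda>(r, x). delta r x)"
      by (auto intro!: injI simp: delta_eq_iff)
    have cE: "card E = c * W" unfolding E_def
      by (subst card_image[OF inj_on_subset[OF inj]]) (simp_all add: cP)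
    have "real (card E) * (1 - \<epsilon>) \<le> real (card (G (- int B) (int W - 1 + int B)))"
    proof (rule card_orthonormal_le_approx)
      show "orthonormal R E" unfolding E_def by (rule orthonormal_delta) (auto simp: P_def)
      show "finite E" unfolding E_def using fin by simp
      show "E \<subseteq> l2_vec R S" by (auto simp: E_def P_def intro!: delta_in_l2_vec ptS)
      show "finite (G (- int B) (int W - 1 + int B))"
        unfolding G_def by (rule pieces_finite_card(1)[OF j pos(3) MN(1)])
      show "G (- int B) (int W - 1 + int B) \<subseteq> l2_vec R S" by (rule GU)
    next
      fix e assume "e \<in> E"
      then obtain k n r where e: "k \<in> K" "n < W" "r < R" "e = delta r (pt k (int n))"
        by (auto simp: E_def P_def)
      then obtain u where u: "u \<in> vseq.span (G (int n - int B) (int n + int B))"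
        "(vec_norm R (e - u))\<^sup>2 \<le> \<epsilon>"
        using closeB unfolding close_def by blast
      have "G (int n - int B) (int n + int B) \<subseteq> G (- int B) (int W - 1 + int B)"
        unfolding G_def using e(2) by (intro pieces_mono) auto
      then show "\<exists>v\<in>vseq.span (G (- int B) (int W - 1 + int B)). (vec_norm R (e - v))\<^sup>2 \<le> \<epsilon>"
        using u vseq.span_mono by blast
    qed
    moreover have "nat (int W - 1 + int B - - int B + 1) = W + 2 * B" using W by linarith
    ultimately show ?thesis
      using pieces_finite_card(2)[OF j pos(3) MN(1), of g L N "- int B" "int W - 1 + int B"]
      unfolding cE G_def by (metis (no_types, opaque_lifting) of_nat_le_iff order_trans)
  qed
  \<comment> \<open>The window inequality will force \<open>W / 2 \<le> 2 * B * (q * L)\<close>;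
    this \<open>W\<close> exceeds the largest permitted value by one.\<close>
  define W where "W = 4 * B * (q * L) + 1"
  have "real (c * W) * (1 - \<epsilon>) = real c * W - W / 2"
    using c by (simp add: \<epsilon>_def field_simps)
  moreover have "real (q * L + 1) * W \<le> real c * W"
    using c by (intro mult_right_mono) (auto simp only: of_nat_le_iff)
  ultimately have "real (q * L + 1) * W - W / 2 \<le> real (q * (W + 2 * B) * L)"
    using window[of W] by (simp add: W_def)
  then have "real W / 2 \<le> real (2 * B * (q * L))" by (simp add: algebra_simps)
  then show False by (simp add: W_def)
qed

section \<open>Finitely supported Parseval frames\<close>

text \<open>A geometric sum of a number \<open>w\<close> with \<open>w ^ M = 1\<close>: it vanishes
  unless \<open>w = 1\<close>, which means that \<open>M\<close> divides \<open>y\<close>.\<close>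

lemma sum_characters:
  assumes "M > 0"
  shows "(\<Sum>m<M. exp (2 * pi * \<i> * of_nat m * of_int y / of_nat M)) =
    (if int M dvd y then of_nat M else 0)"
proof -
  define w where "w = exp (2 * pi * \<i> * of_int y / of_nat M)"
  have pow: "exp (2 * pi * \<i> * of_nat m * of_int y / of_nat M) = w ^ m" for m
    by (simp add: w_def ac_simps flip: exp_of_nat_mult)
  have one: "w = 1 \<longleftrightarrow> int M dvd y"
  proof -
    have "w = 1 \<longleftrightarrow> (\<exists>n::int. real_of_int y = of_int (n * int M))"
      using assms by (auto simp: w_def exp_eq_1 field_simps)
    also have "\<dots> \<longleftrightarrow> int M dvd y"
      unfolding of_int_eq_iff by (auto simp: dvd_def mult.commute)
    finally show ?thesis .
  qed
  have "w ^ M = exp ((2 * of_int y * pi) * \<i>)"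
    using assms by (simp add: w_def ac_simps flip: exp_of_nat_mult)
  then have "w ^ M = 1" by (simp only: exp_integer_2pi[OF Ints_of_int])
  then show ?thesis
    unfolding pow using one by (auto simp: sum_gp_strict)
qed

text \<open>Expanding the square leaves character sums at \<open>y t - y s\<close>. Distinct
  residues kill the off-diagonal terms; each diagonal term gains the factor
  \<open>M\<close>.\<close>

lemma characters_parseval:
  fixes a :: "'a \<Rightarrow> complex" and y :: "'a \<Rightarrow> int"
  assumes M: "M > 0" and A: "finite A"
    and inj: "\<And>s t. s \<in> A \<Longrightarrow> t \<in> A \<Longrightarrow> y s mod int M = y t mod int M \<Longrightarrow> s = t"
  shows "(\<Sum>m<M. (cmod (\<Sum>t\<in>A. exp (2 * pi * \<i> * of_nat m * of_int (y t) / of_nat M) * a t))\<^sup>2) =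
    real M * (\<Sum>t\<in>A. (cmod (a t))\<^sup>2)"
proof -
  define e where "e m x = exp (2 * pi * \<i> * of_nat m * of_int x / of_nat M)" for m and x :: int
  have e: "e m x * cnj (e m z) = e m (x - z)" for m x z
    by (simp add: e_def exp_cnj diff_divide_distrib algebra_simps flip: exp_add)
  have "complex_of_real (\<Sum>m<M. (cmod (\<Sum>t\<in>A. e m (y t) * a t))\<^sup>2) =
      (\<Sum>m<M. \<Sum>t\<in>A. \<Sum>s\<in>A. a t * cnj (a s) * e m (y t - y s))"
    unfolding of_real_sum complex_norm_square
    by (simp add: sum_product e[symmetric] ac_simps)
  also have "\<dots> = (\<Sum>t\<in>A. \<Sum>s\<in>A. a t * cnj (a s) * (\<Sum>m<M. e m (y t - y s)))"
    unfolding sum_distrib_left by (subst sum.swap) (intro sum.cong refl sum.swap)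
  also have "\<dots> = (\<Sum>t\<in>A. \<Sum>s\<in>A. if s = t then of_nat M * (a t * cnj (a t)) else 0)"
  proof (intro sum.cong refl)
    fix t s assume "t \<in> A" "s \<in> A"
    then have "int M dvd y t - y s \<longleftrightarrow> s = t"
      using inj by (auto simp: mod_eq_dvd_iff[symmetric])
    then show "a t * cnj (a s) * (\<Sum>m<M. e m (y t - y s)) =
        (if s = t then of_nat M * (a t * cnj (a t)) else 0)"
      unfolding e_def sum_characters[OF M] by simp
  qed
  also have "\<dots> = (\<Sum>t\<in>A. of_nat M * (a t * cnj (a t)))"
    using A by simp
  also have "\<dots> = complex_of_real (real M * (\<Sum>t\<in>A. (cmod (a t))\<^sup>2))"
    by (simp only: of_real_mult of_real_sum complex_norm_square sum_distrib_left of_real_of_nat_eq)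
  finally show ?thesis unfolding e_def of_real_eq_iff .
qed


lemma gabor_sum_delta:
  assumes "g l = (\<Sum>t\<in>A. vec_scale c (delta (r t) (x t)))"
  shows "gabor g M N (m, n, l) = (\<Sum>t\<in>A. vec_scale
    (c * exp (2 * pi * \<i> * of_nat m * of_int (x t + n * int N) / of_nat M)) (delta (r t) (x t + n * int N)))"
proof (intro ext)
  fix s j
  define e where "e y = exp (2 * pi * \<i> * of_nat m * of_int y / of_nat M)" for y :: int
  have "gabor g M N (m, n, l) s j = (\<Sum>t\<in>A. e j * (c * delta (r t) (x t) s (j - n * int N)))"
    unfolding gabor_def modulation_def translation_def prod.case assms sum_vseq_apply e_def
      sum_distrib_left by (simp only: vec_scale_def)
  also have "\<dots> = (\<Sum>t\<in>A. vec_scale (c * e (x t + n * int N)) (delta (r t) (x t + n * int N)) s j)"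
  proof (rule sum.cong[OF refl])
    fix t
    have "j - n * int N = x t \<longleftrightarrow> j = x t + n * int N" by auto
    then show "e j * (c * delta (r t) (x t) s (j - n * int N)) =
        vec_scale (c * e (x t + n * int N)) (delta (r t) (x t + n * int N)) s j"
      by (auto simp: vec_scale_def delta_def)
  qed
  finally show "gabor g M N (m, n, l) s j = (\<Sum>t\<in>A. vec_scale
      (c * exp (2 * pi * \<i> * of_nat m * of_int (x t + n * int N) / of_nat M)) (delta (r t) (x t + n * int N))) s j"
    by (simp only: sum_vseq_apply e_def)
qed

text \<open>Components and positions are merged into one index set so that the squared norm can be
  reindexed along a bijection onto \<open>{..<R} \<times> S\<close>.\<close>

lemma vec_norm_has_sum:
  assumes "f \<in> l2_vec R S"
  shows "((\<lambda>(r, j). (cmod (f r j))\<^sup>2) has_sum (vec_norm R f)\<^sup>2) ({..<R} \<times> S)"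
proof -
  have *: "((\<lambda>j. (cmod (f r j))\<^sup>2) has_sum (\<Sum>\<^sub>\<infinity>j. (cmod (f r j))\<^sup>2)) S" if "r \<in> {..<R}" for r
  proof -
    have f: "f r \<in> l2 S" using assms that by (simp add: l2_vec_def)
    then have "((\<lambda>j. (cmod (f r j))\<^sup>2) has_sum (\<Sum>\<^sub>\<infinity>j. (cmod (f r j))\<^sup>2)) UNIV"
      by (simp add: l2_def)
    moreover have "f r j = 0" if "j \<notin> S" for j using f that by (simp add: l2_def)
    ultimately show ?thesis
      by (subst has_sum_cong_neutral[where T = UNIV and g = "\<lambda>j. (cmod (f r j))\<^sup>2"]) auto
  qed
  have fin: "((\<lambda>r. \<Sum>\<^sub>\<infinity>j. (cmod (f r j))\<^sup>2) has_sum (vec_norm R f)\<^sup>2) {..<R}"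
    by (rule has_sum_finiteI) (simp_all add: vec_norm_power2)
  have summ: "(\<lambda>(r, j). (cmod (f r j))\<^sup>2) summable_on {..<R} \<times> S"
    by (rule summable_on_SigmaI[OF _ has_sum_imp_summable[OF fin]]) (use * in auto)
  show ?thesis
    by (rule has_sum_SigmaI[OF _ fin summ]) (use * in auto)
qed

text \<open>
  Distinct residues modulo \<open>M\<close> within one window make the sum over the modulations diagonal, by
  orthogonality of characters; the bijection then makes every pair \<open>(r, j)\<close> occur exactly once.
\<close>

lemma parseval_of_delta_windows:
  fixes lab :: "'t \<Rightarrow> nat" and r :: "'t \<Rightarrow> nat" and x :: "'t \<Rightarrow> int"
  assumes M: "M > 0" and per: "periodic_set N S" and T: "finite T"
    and lab: "\<And>t. t \<in> T \<Longrightarrow> lab t < L" and r: "\<And>t. t \<in> T \<Longrightarrow> r t < R" and x: "\<And>t. t \<in> T \<Longrightarrow> x t \<in> S"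
    and inj: "\<And>s t. s \<in> T \<Longrightarrow> t \<in> T \<Longrightarrow> lab s = lab t \<Longrightarrow> x s mod int M = x t mod int M \<Longrightarrow> s = t"
    and bij: "bij_betw (\<lambda>(n, t). (r t, x t + n * int N)) (UNIV \<times> T) ({..<R} \<times> S)"
    and g: "g = (\<lambda>l. \<Sum>t\<in>{t\<in>T. lab t = l}. vec_scale (of_real (1 / sqrt M)) (delta (r t) (x t)))"
  shows "\<forall>l<L. g l \<in> l2_vec R S"
    and "is_parseval_frame R (l2_vec R S) (gabor_index L M) (gabor g M N)"
proof -
  have gU: "g l \<in> l2_vec R S" for l
    unfolding g by (intro l2_vec_sum l2_vec_scale delta_in_l2_vec) (use r x in auto)
  then show "\<forall>l<L. g l \<in> l2_vec R S" by simp
  have xS: "x t + n * int N \<in> S" if "t \<in> T" for t n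
    using x[OF that] per by (simp add: periodic_set_def)
  have has_sum: "((\<lambda>i. (cmod (vec_inner R f (gabor g M N i)))\<^sup>2) has_sum (vec_norm R f)\<^sup>2) (gabor_index L M)"
    if f: "f \<in> l2_vec R S" for f
  proof -
    \<comment> \<open>The translation index comes first, so that the sum splits into an outer sum
      over \<open>n\<close> and a finite inner one over \<open>m\<close> and
      \<open>l\<close>.\<close>
    define a where "a = (\<lambda>(n, m, l). (cmod (vec_inner R f (gabor g M N (m, n, l))))\<^sup>2)"
    define h where "h n t = (cmod (f (r t) (x t + n * int N)))\<^sup>2" for n t
    have sum_m: "(\<Sum>m<M. a (n, m, l)) = (\<Sum>t\<in>{t\<in>T. lab t = l}. h n t)" for n l
    proof -
      define A where "A = {t\<in>T. lab t = l}"
      define e where "e m y = exp (2 * pi * \<i> * of_nat m * of_int y / of_nat M)" for m and y :: int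
      have A: "finite A" "\<And>t. t \<in> A \<Longrightarrow> t \<in> T" using T by (auto simp: A_def)
      have "cmod (vec_inner R f (gabor g M N (m, n, l))) =
          cmod (\<Sum>t\<in>A. e m (x t + n * int N) * (of_real (1 / sqrt M) * cnj (f (r t) (x t + n * int N))))" for m
      proof -
        have "vec_inner R f (gabor g M N (m, n, l)) =
            (\<Sum>t\<in>A. cnj (of_real (1 / sqrt M) * e m (x t + n * int N)) * f (r t) (x t + n * int N))"
          unfolding gabor_sum_delta[OF fun_cong[OF g]] e_def[symmetric] A_def[symmetric]
          using A r xS f
          by (subst vec_inner_sum_right[of _ _ R S])
            (auto intro!: l2_vec_scale delta_in_l2_vec simp: vec_inner_scale_right vec_inner_delta_right)
        also have "\<dots> = cnj (\<Sum>t\<in>A. e m (x t + n * int N) * (of_real (1 / sqrt M) * cnj (f (r t) (x t + n * int N))))"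
          by (simp add: ac_simps)
        finally show ?thesis by (simp only: complex_mod_cnj)
      qed
      then have "(\<Sum>m<M. a (n, m, l)) = (\<Sum>m<M. (cmod (\<Sum>t\<in>A. e m (x t + n * int N) *
          (of_real (1 / sqrt M) * cnj (f (r t) (x t + n * int N)))))\<^sup>2)"
        unfolding a_def prod.case by simp
      also have "\<dots> = real M * (\<Sum>t\<in>A. (cmod (of_real (1 / sqrt M) * cnj (f (r t) (x t + n * int N))))\<^sup>2)"
        unfolding e_def
      proof (rule characters_parseval[OF M A(1)])
        fix s t assume "s \<in> A" "t \<in> A" "(x s + n * int N) mod int M = (x t + n * int N) mod int M"
        then show "s = t" using inj[of s t] by (simp add: A_def mod_eq_dvd_iff)
      qed
      \<comment> \<open>The factor \<open>M\<close> from the characters cancels the squared mass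
        \<open>1 / M\<close>.\<close>
      also have "\<dots> = (\<Sum>t\<in>A. h n t)"
        using M unfolding sum_distrib_left
        by (intro sum.cong) (simp_all add: h_def norm_mult norm_divide power_mult_distrib power_divide)
      finally show ?thesis by (simp add: A_def)
    qed
    have sum_ml: "(\<Sum>y\<in>{..<M} \<times> {..<L}. a (n, y)) = (\<Sum>t\<in>T. h n t)" for n
    proof -
      have "(\<Sum>y\<in>{..<M} \<times> {..<L}. a (n, y)) = (\<Sum>l<L. \<Sum>m<M. a (n, m, l))"
        by (subst sum.swap) (simp add: sum.cartesian_product)
      also have "\<dots> = (\<Sum>t\<in>T. h n t)"
        unfolding sum_m by (rule sum.group[OF T]) (use lab in auto)
      finally show ?thesis .
    qed
    have "((\<lambda>(r, j). (cmod (f r j))\<^sup>2) has_sum (vec_norm R f)\<^sup>2) ({..<R} \<times> S)"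
      by (rule vec_norm_has_sum[OF f])
    then have "((\<lambda>y. (case (case y of (n, t) \<Rightarrow> (r t, x t + n * int N)) of (r, j) \<Rightarrow> (cmod (f r j))\<^sup>2))
        has_sum (vec_norm R f)\<^sup>2) (UNIV \<times> T)"
      by (subst has_sum_reindex_bij_betw[OF bij])
    then have "((\<lambda>(n, t). h n t) has_sum (vec_norm R f)\<^sup>2) (UNIV \<times> T)"
      by (simp add: h_def case_prod_unfold)
    then have n: "((\<lambda>n. \<Sum>t\<in>T. h n t) has_sum (vec_norm R f)\<^sup>2) UNIV"
      by (rule has_sum_SigmaD) (use T in \<open>auto intro: has_sum_finiteI\<close>)
    have y: "((\<lambda>y. a (n, y)) has_sum (\<Sum>t\<in>T. h n t)) ({..<M} \<times> {..<L})" for n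
      by (rule has_sum_finiteI) (simp_all add: sum_ml)
    have "a summable_on UNIV \<times> {..<M} \<times> {..<L}"
      by (rule summable_on_SigmaI[OF y has_sum_imp_summable[OF n]]) (auto simp: a_def)
    then have a: "(a has_sum (vec_norm R f)\<^sup>2) (UNIV \<times> {..<M} \<times> {..<L})"
      by (rule has_sum_SigmaI[OF y n])
    show ?thesis
      by (rule iffD1[OF has_sum_reindex_bij_witness[where i = "\<lambda>(m, n, l). (n, m, l)" and j = "\<lambda>(n, m, l). (m, n, l)"] a])
        (auto simp: gabor_index_def a_def)
  qed
  have "countable (gabor_index L M)" by (simp add: gabor_index_def)
  moreover have "gabor g M N ` gabor_index L M \<subseteq> l2_vec R S"
    using gabor_in_l2_vec[OF per gU] by (auto simp: gabor_index_def)
  ultimately show "is_parseval_frame R (l2_vec R S) (gabor_index L M) (gabor g M N)"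
    unfolding is_parseval_frame_def frame_bounds_def
    using has_sum_imp_summable[OF has_sum] infsumI[OF has_sum] by simp
qed


text \<open>In each class \<open>c\<close> modulo \<open>d\<close>, the injection
  \<open>\<phi> c\<close> assigns to a point a generator and a shift by a multiple of
  \<open>N\<close>. The shift keeps the point in its orbit under translation by \<open>N\<close>, so
  the covering of \<open>S\<close> is unaffected, but separates residues modulo \<open>M\<close>
  among points of the class sharing a generator.\<close>

lemma card_le_imp_parseval:
  fixes p q d :: nat
  assumes per: "periodic_set N S" and MN: "M = q * d" "N = p * d"
    and pos: "0 < d" "0 < p" "0 < q" and cop: "coprime p q"
    and card: "\<And>j. j < d \<Longrightarrow> R * card (K_set p M S (int j)) \<le> q * L"
  shows "\<exists>g. (\<forall>l<L. g l \<in> l2_vec R S) \<and>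
    is_parseval_frame R (l2_vec R S) (gabor_index L M) (gabor g M N)"
proof -
  define K where "K c = K_set p M S (int c)" for c
  have K: "finite (K c)" "\<And>k. k \<in> K c \<Longrightarrow> k < p" for c by (auto simp: K_def K_set_def)
  have "\<exists>\<phi>. \<phi> ` (K c \<times> {..<R}) \<subseteq> {..<L} \<times> {..<q} \<and> inj_on \<phi> (K c \<times> {..<R})" if "c < d" for c
    using card[OF that] K(1)
    by (intro card_le_inj) (simp_all add: card_cartesian_product K_def mult.commute)
  then obtain \<phi> where \<phi>: "\<And>c. c < d \<Longrightarrow> \<phi> c ` (K c \<times> {..<R}) \<subseteq> {..<L} \<times> {..<q}"
    "\<And>c. c < d \<Longrightarrow> inj_on (\<phi> c) (K c \<times> {..<R})"
    by metis
  define T where "T = Sigma {..<d} (\<lambda>c. K c \<times> {..<R})"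
  define lab where "lab = (\<lambda>(c, k, r). fst (\<phi> c (k, r)))"
  define r where "r = (\<lambda>(c::nat, k::nat, r::nat). r)"
  define x where "x = (\<lambda>(c, k, r). int c + int k * int M + int (snd (\<phi> c (k, r))) * int N)"
  define g where "g = (\<lambda>l. \<Sum>t\<in>{t\<in>T. lab t = l}. vec_scale (of_real (1 / sqrt M)) (delta (r t) (x t)))"
  have \<phi>': "fst (\<phi> c (k, s)) < L" "snd (\<phi> c (k, s)) < q" if "(c, k, s) \<in> T" for c k s
    using \<phi>(1)[of c] that by (force simp: T_def)+
  have perD: "y + n * int N \<in> S" if "y \<in> S" for y n
    using per that by (simp add: periodic_set_def)
  have xmod: "(int c + int k * int M + n * int N) mod int d = int c" if "c < d" for c k n
  proof -
    have "int c + int k * int M + n * int N = int c + (int k * int q + n * int p) * int d"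
      by (simp add: MN algebra_simps)
    then show ?thesis using that by (simp only: mod_mult_self1) simp
  qed
  have class_eq: "c = c'"
    if "(int c + int k * int M + n * int N) mod int d = (int c' + int k' * int M + n' * int N) mod int d"
      "c < d" "c' < d" for c c' k k' n n'
    using that by (simp only: xmod of_nat_eq_iff)
  have M_T: "0 < M" "finite T" using MN pos K by (auto simp: T_def)
  have bounds: "lab t < L" "r t < R" if "t \<in> T" for t
    using that \<phi>' by (auto simp: lab_def r_def) (auto simp: T_def)
  have xS: "x t \<in> S" if "t \<in> T" for t
    using that by (auto simp: x_def T_def K_def K_set_def intro: perD)
  have inj: "s = t" if s: "s \<in> T" and t: "t \<in> T" and l: "lab s = lab t"
    and x: "x s mod int M = x t mod int M" for s t
  proof -
    obtain c k i where s': "s = (c, k, i)" by (cases s)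
    obtain c' k' i' where t': "t = (c', k', i')" by (cases t)
    define n where "n = snd (\<phi> c (k, i))"
    define n' where "n' = snd (\<phi> c' (k', i'))"
    have T: "c < d" "k \<in> K c" "i < R" "c' < d" "k' \<in> K c'" "i' < R"
      using s t by (auto simp: T_def s' t')
    have "x s mod int d = x t mod int d"
      using x by (metis MN(1) dvd_triv_right mod_mod_cancel of_nat_dvd_iff)
    then have c: "c = c'"
      using class_eq T(1,4) by (simp add: x_def s' t')
    \<comment> \<open>Modulo \<open>M\<close> the multiples of \<open>M\<close> disappear and only
      the shifts \<open>n\<close> and \<open>n'\<close> remain; cancelling \<open>d\<close> and
      \<open>p\<close> leaves \<open>q\<close> dividing their difference.\<close>
    have "int M dvd x s - x t" using x by (simp only: mod_eq_dvd_iff)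
    also have "x s - x t = (int k - int k') * int M + (int n - int n') * int N"
      by (simp add: x_def s' t' c n_def n'_def algebra_simps)
    finally have "int M dvd (int n - int n') * int N"
      by (metis dvd_add_right_iff dvd_triv_right)
    then have "int d * int q dvd int d * ((int n - int n') * int p)"
      by (simp add: MN ac_simps)
    then have "int q dvd (int n - int n') * int p" using pos(1) by simp
    then have "int q dvd int n - int n'"
      using cop by (simp add: coprime_dvd_mult_left_iff coprime_commute)
    moreover have "n < q" "n' < q" using \<phi>'(2) s t by (auto simp: n_def n'_def s' t')
    ultimately have "n = n'"
      using dvd_imp_le_int[of "int n - int n'" "int q"] by fastforce
    then have "\<phi> c (k, i) = \<phi> c (k', i')"
      using l by (simp add: prod_eq_iff lab_def s' t' c n_def n'_def)
    from inj_onD[OF \<phi>(2)[OF T(1)] this] show ?thesis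
      using T by (simp add: s' t' c)
  qed
  have bij: "bij_betw (\<lambda>(n, t). (r t, x t + n * int N)) (UNIV \<times> T) ({..<R} \<times> S)"
    unfolding bij_betw_def
  proof (intro conjI equalityI subsetI)
    show "inj_on (\<lambda>(n, t). (r t, x t + n * int N)) (UNIV \<times> T)"
    proof (rule inj_onI, clarsimp, goal_cases)
      case (1 n c k i n' c' k' i')
      \<comment> \<open>The built-in shift is absorbed into the translation index, which reduces
        injectivity to uniqueness of the lattice representation.\<close>
      define m where "m = int (snd (\<phi> c (k, i))) + n"
      define m' where "m' = int (snd (\<phi> c' (k', i'))) + n'"
      have T: "c < d" "k \<in> K c" "c' < d" "k' \<in> K c'" using 1 by (auto simp: T_def)
      have eq: "int c + int k * int M + m * int N = int c' + int k' * int M + m' * int N"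
        using 1 by (simp add: x_def m_def m'_def algebra_simps)
      then have c: "c = c'" using class_eq[of c k m c' k' m'] T by simp
      then have "k = k' \<and> m = m'"
        using eq inj_lattice_points[OF pos(1) cop pos(2), of k m k' m'] T K(2) by (simp add: MN)
      then show ?case using c 1 by (auto simp: r_def m_def m'_def)
    qed
  next
    fix z assume "z \<in> (\<lambda>(n, t). (r t, x t + n * int N)) ` (UNIV \<times> T)"
    then show "z \<in> {..<R} \<times> S"
      using xS perD by (auto simp: T_def r_def)
  next
    fix z assume "z \<in> {..<R} \<times> S"
    then obtain s j where z: "z = (s, j)" "s < R" "j \<in> S" by auto
    define c where "c = nat (j mod int d)"
    have c: "int c = j mod int d" "c < d"
      using pos by (auto simp: c_def nat_less_iff)
    define y where "y = j div int d"
    have j: "j = int c + int d * y" by (simp add: c y_def)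
    \<comment> \<open>Bezout writes \<open>y\<close> as a combination of \<open>q\<close> and
      \<open>p\<close>; the coefficient of \<open>q\<close> reduced modulo \<open>p\<close> is
      \<open>k\<close>, and \<open>w\<close> takes up the rest.\<close>
    obtain u v where uv: "u * int q + v * int p = 1"
      using bezout_int[of "int q" "int p"] cop by (metis coprime_commute coprime_iff_gcd_eq_1 coprime_int_iff)
    define k where "k = nat (u * y mod int p)"
    have k: "int k = u * y mod int p" "k < p" using pos by (auto simp: k_def nat_less_iff)
    define w where "w = v * y + (u * y div int p) * int q"
    have "y = (u * int q + v * int p) * y" by (simp add: uv)
    also have "\<dots> = (u * y) * int q + v * y * int p" by (simp add: algebra_simps)
    also have "u * y = int k + int p * (u * y div int p)" by (simp add: k)
    finally have "y = int k * int q + w * int p" by (simp add: w_def algebra_simps)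
    then have jk: "j = int c + int k * int M + w * int N"
      by (simp add: j MN algebra_simps)
    then have "int c + int k * int M \<in> S" using perD[OF z(3), of "- w"] by simp
    then have t: "(c, k, s) \<in> T" using c k z by (simp add: T_def K_def K_set_def)
    show "z \<in> (\<lambda>(n, t). (r t, x t + n * int N)) ` (UNIV \<times> T)"
    \<comment> \<open>The point \<open>x (c, k, s)\<close> already contains a shift, which is
      subtracted from \<open>w\<close>.\<close>
    proof (rule image_eqI[of _ _ "(w - int (snd (\<phi> c (k, s))), (c, k, s))"])
      show "z = (case (w - int (snd (\<phi> c (k, s))), (c, k, s)) of (n, t) \<Rightarrow> (r t, x t + n * int N))"
        by (simp add: z r_def x_def jk algebra_simps)
    qed (use t in simp)
  qed
  note parseval_of_delta_windows[OF M_T(1) per M_T(2) bounds xS inj bij g_def]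
  then show ?thesis by blast
qed

theorem theorem4p4:
  fixes L M N R p q :: nat and S :: "int set"
  assumes "L \<ge> 1" and "M \<ge> 1" and "N \<ge> 1" and "R \<ge> 1"
    and "p \<ge> 1" and "q \<ge> 1"
    and "coprime p q"
    and "real N / real M = real p / real q"
    and "periodic_set N S"
  shows
    "((\<exists>g. (\<forall>l<L. g l \<in> l2_vec R S) \<and>
          is_parseval_frame R (l2_vec R S) (gabor_index L M) (gabor g M N))
      \<longleftrightarrow>
      (\<exists>g. (\<forall>l<L. g l \<in> l2_vec R S) \<and>
          is_frame R (l2_vec R S) (gabor_index L M) (gabor g M N)))
     \<and>
     ((\<exists>g. (\<forall>l<L. g l \<in> l2_vec R S) \<and>
          is_frame R (l2_vec R S) (gabor_index L M) (gabor g M N))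
      \<longleftrightarrow>
      (\<exists>g. (\<forall>l<L. g l \<in> l2_vec R S) \<and>
          is_complete R (l2_vec R S) (gabor_index L M) (gabor g M N)))
     \<and>
     ((\<exists>g. (\<forall>l<L. g l \<in> l2_vec R S) \<and>
          is_complete R (l2_vec R S) (gabor_index L M) (gabor g M N))
      \<longleftrightarrow>
      (\<forall>j<M div q. R * card (K_set p M S (int j)) \<le> q * L))"
    (is "(?parseval \<longleftrightarrow> ?frame) \<and> (?frame \<longleftrightarrow> ?complete) \<and> (?complete \<longleftrightarrow> ?card)")
proof -
  \<comment> \<open>Coprimality makes this division exact, so that \<open>M = q * d\<close> and
    \<open>N = p * d\<close>.\<close>
  define d where "d = M div q"
  have "real (N * q) = real (p * M)" using assms by (simp add: field_simps)
  then have Nq: "N * q = p * M" by (simp only: of_nat_eq_iff)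
  then have "q dvd M"
    using assms(7) by (metis coprime_commute coprime_dvd_mult_right_iff dvd_triv_right)
  then have M: "M = q * d" by (simp add: d_def)
  then have N: "N = p * d" using Nq assms(6) by simp
  have pos: "0 < d" "0 < p" "0 < q" using assms M by (auto intro: gr0I)
  \<comment> \<open>The four implications form a cycle: Parseval frame, frame, completeness,
    cardinality bound, and back.\<close>
  have "?parseval \<Longrightarrow> ?frame"
    unfolding is_parseval_frame_def is_frame_def by blast
  moreover have "?frame \<Longrightarrow> ?complete"
    unfolding is_frame_def using frame_imp_complete by blast
  moreover have "?card" if complete: ?complete
  proof -
    obtain g where g: "\<And>l. l < L \<Longrightarrow> g l \<in> l2_vec R S"
      "is_complete R (l2_vec R S) (gabor_index L M) (gabor g M N)"
      using complete by blast
    show ?thesis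
      using complete_gabor_imp_card_le[OF g(2,1) assms(9) M N pos assms(7)] by (simp add: d_def)
  qed
  moreover have "?card \<Longrightarrow> ?parseval"
    using card_le_imp_parseval[OF assms(9) M N pos assms(7)] by (simp add: d_def)
  ultimately show ?thesis by blast
qed

end
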